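(* Let $n\in\mathbb N$. For every multiplication rule $C\in\mathcal C^n$, the graded abelian group $OH^n=\bigoplus_{a,b\in B^n} b(OH^n)a$, equipped with the multiplication $*_C$ determined by $C$, is a ring $OH^n_C$ (graded, unital with unit $\sum_{a\in B^n}1_a$, and not necessarily associative). Thus there is a family of rings $\{OH^n_C\}_{C\in\mathcal C^n}$.
   Context: **Diagrams.** $B^n$ is the set of crossingless matchings of the $2n$ points $\{1,\dots,2n\}$ on a line: partitions of the points into $n$ pairs (arcs) which can be drawn as $n$ pairwise disjoint half-circles on one side of the line (arcs may be nested). $W$ denotes reflection in the line. For $a,b\in B^n$, $W(b)a$ is the collection of disjoint circles in the plane obtained by gluing the reflection of $b$ to $a$ along the $2n$ points; its circles correspond to the connected components of the graph on $\{1,\dots,2n\}$ whose edges are the arcs of $a$ and of $b$. $|W(b)a|$ is the number of circles. **The group $OH^n$.** For a collection of circles $S$, $V(S)$ is the free abelian group on the circles of $S$. Put $b(OH^n)a:=\bigwedge^*V(W(b)a)$ (exterior algebra over $\mathbb Z$), graded so that a wedge of $k$ circles has degree $2k+n-|W(b)a|$. Let ${}_b1_a$ be the unit of this exterior algebra and $1_a:={}_a1_a$. Set $OH^n:=\bigoplus_{a,b\in B^n}b(OH^n)a$. **Multiplication rules.** A multiplication rule $C$ consists, for each triple $(c,b,a)\in (B^n)^3$, of (i) a total order on the points $\{1,\dots,2n\}$ such that whenever $i,j$ are joined by an arc of $b$ and $k$ lies strictly between $i$ and $j$ (in the usual order), then $i$ or $j$ precedes $k$ in the order of the rule; and (ii)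 an orientation $i\to j$ or $j\to i$ of each arc $\{i,j\}$ of $b$. $\mathcal C^n$ is the set of all multiplication rules. **Multiplication.** If $c\neq b$ the product of an element of $d(OH^n)c$ with an element of $b(OH^n)a$ is $0$. For $x\in c(OH^n)b$, $y\in b(OH^n)a$, place $W(c)b$ above $W(b)a$; this gives a collection of circles $D_0$ and the element $x\wedge y\in\bigwedge^*V(D_0)$ (using $V(D_0)=V(W(c)b)\oplus V(W(b)a)$). Go through the points in the order given by $C$ for $(c,b,a)$; each time an arc $\{i,j\}$ of $b$ is met for the first time, do a surgery: delete the copy of this arc in $W(c)b$ and its mirror copy in $W(b)a$, and join the upper point $i$ to the lower point $i$ and the upper point $j$ to the lower point $j$ by vertical segments. Each surgery either merges two circles into one or splits one circle into two. To a merge $S_1\to S_2$ of $a_1,a_2$ into $b_1$ associate the map $\bigwedge^*V(S_1)\to\bigwedge^*V(S_2)$ induced by $a_1,a_2\mapsto b_1$ and the identity on the other circles. To a split $S_1\to S_2$ of a circle $e$ into the circle $e_i$ through point $i$ and the circle $e_j$ through point $j$, with orientation $i\to j$ of the arc, associate the map $x\mapsto (e_i-e_j)\wedge x'$, where $x'$ is obtained from $x$ by replacing $e$ by $e_i$ (equivalently by $e_j$). After all $n$ surgeries one obtains $W(c)a$, and $x*_Cy\in c(OH^n)a$ is the image of $x\wedge y$ under the composite of these maps. "Ring" here does not require associativity. *)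

theory Defs
  imports Complex_Main "HOL-Algebra.QuotRing" "HOL-Algebra.Free_Abelian_Groups"
    "HOL-Library.Disjoint_Sets"
begin

section \<open>Graded rings that need not be associative\<close>

locale nonassoc_ring = abelian_group R for R (structure) +
  assumes m_closed: "\<lbrakk>x \<in> carrier R; y \<in> carrier R\<rbrakk> \<Longrightarrow> x \<otimes> y \<in> carrier R"
    and one_closed: "\<one> \<in> carrier R"
    and l_one: "x \<in> carrier R \<Longrightarrow> \<one> \<otimes> x = x"
    and r_one: "x \<in> carrier R \<Longrightarrow> x \<otimes> \<one> = x"
    and l_distr: "\<lbrakk>x \<in> carrier R; y \<in> carrier R; z \<in> carrier R\<rbrakk>
      \<Longrightarrow> (x \<oplus> y) \<otimes> z = x \<otimes> z \<oplus> y \<otimes> z"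
    and r_distr: "\<lbrakk>x \<in> carrier R; y \<in> carrier R; z \<in> carrier R\<rbrakk>
      \<Longrightarrow> z \<otimes> (x \<oplus> y) = z \<otimes> x \<oplus> z \<otimes> y"

text \<open>The additive group is the internal direct sum of the subgroups \<open>D d\<close>, \<open>d\<close> an integer.\<close>

locale graded_nonassoc_ring = nonassoc_ring R for R (structure) +
  fixes D :: "int \<Rightarrow> 'a set"
  assumes D_subgroup: "additive_subgroup (D d) R"
    and D_direct_sum: "x \<in> carrier R \<Longrightarrow>
      \<exists>!y. (\<forall>d. y d \<in> D d) \<and> finite {d. y d \<noteq> \<zero>} \<and> x = (\<Oplus>d\<in>{d. y d \<noteq> \<zero>}. y d)"
    and D_mult: "\<lbrakk>x \<in> D d; y \<in> D e\<rbrakk> \<Longrightarrow> x \<otimes> y \<in> D (d + e)"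
    and D_one: "\<one> \<in> D 0"


section \<open>Exterior algebra of the free abelian group on a set\<close>

text \<open>
  The tensor algebra of the free abelian group on \<open>S\<close> is the free abelian group on the words over
  \<open>S\<close>, multiplied by concatenation; words of length \<open>k\<close> span the \<open>k\<close>-th tensor power. The exterior
  algebra is its quotient by the two-sided ideal generated by the squares of all elements of the
  free abelian group on \<open>S\<close> (not only of the basis elements).
\<close>

definition tensor_mult :: "('c list \<Rightarrow>\<^sub>0 int) \<Rightarrow> ('c list \<Rightarrow>\<^sub>0 int) \<Rightarrow> ('c list \<Rightarrow>\<^sub>0 int)"
  where "tensor_mult s t = frag_extend (\<lambda>u. frag_extend (\<lambda>v. frag_of (u @ v)) t) s"

definition tensor_algebra :: "'c set \<Rightarrow> ('c list \<Rightarrow>\<^sub>0 int) ring"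
  where "tensor_algebra S =
    \<lparr>carrier = carrier (free_Abelian_group (lists S)), monoid.mult = tensor_mult, one = frag_of [],
     ring.zero = 0, ring.add = (+)\<rparr>"

definition tensor_vec :: "('c \<Rightarrow>\<^sub>0 int) \<Rightarrow> ('c list \<Rightarrow>\<^sub>0 int)"
  where "tensor_vec = frag_extend (\<lambda>s. frag_of [s])"

definition exterior_ideal :: "'c set \<Rightarrow> ('c list \<Rightarrow>\<^sub>0 int) set"
  where "exterior_ideal S =
    genideal (tensor_algebra S)
      {tensor_mult (tensor_vec v) (tensor_vec v) | v. v \<in> carrier (free_Abelian_group S)}"

definition exterior_algebra :: "'c set \<Rightarrow> ('c list \<Rightarrow>\<^sub>0 int) set ring"
  where "exterior_algebra S = tensor_algebra S Quot exterior_ideal S"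

definition exterior_class :: "'c set \<Rightarrow> ('c list \<Rightarrow>\<^sub>0 int) \<Rightarrow> ('c list \<Rightarrow>\<^sub>0 int) set"
  where "exterior_class S t = exterior_ideal S +>\<^bsub>tensor_algebra S\<^esub> t"

definition exterior_vec :: "'c set \<Rightarrow> ('c \<Rightarrow>\<^sub>0 int) \<Rightarrow> ('c list \<Rightarrow>\<^sub>0 int) set"
  where "exterior_vec S v = exterior_class S (tensor_vec v)"

text \<open>
  The map from the exterior algebra over some \<open>S'\<close> to the one over \<open>S\<close> that is induced by a map
  \<open>f\<close> from \<open>S'\<close> to \<open>S\<close>; \<open>S'\<close> is determined by the argument, which is a coset. The image
  under \<open>the_elem\<close> is a singleton because \<open>f\<close> carries the one ideal into the other.
\<close>

definition exterior_map ::
    "'d set \<Rightarrow> ('c \<Rightarrow> 'd) \<Rightarrow> ('c list \<Rightarrow>\<^sub>0 int) set \<Rightarrow> ('d list \<Rightarrow>\<^sub>0 int) set"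
  where "exterior_map S f X =
    the_elem ((\<lambda>t. exterior_class S (frag_extend (\<lambda>w. frag_of (map f w)) t)) ` X)"


section \<open>Crossingless matchings and circles\<close>

type_synonym matching = "nat set set"

definition half_circle :: "nat set \<Rightarrow> (real \<times> real) set"
  where "half_circle A = {(x, y). y \<ge> 0 \<and>
    (x - (real (Min A) + real (Max A)) / 2)\<^sup>2 + y\<^sup>2 = ((real (Max A) - real (Min A)) / 2)\<^sup>2}"

definition crossingless_matchings :: "nat \<Rightarrow> matching set"
  where "crossingless_matchings n = {M. partition_on {1..2 * n} M \<and> (\<forall>A\<in>M. card A = 2) \<and>
    pairwise (\<lambda>A B. disjnt (half_circle A) (half_circle B)) M}"

text \<open>Edges are two-element sets; a circle is given by the set of points that lie on it.\<close>

definition connected_comp :: "'v set set \<Rightarrow> 'v \<Rightarrow> 'v set"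
  where "connected_comp E v = {(x, y). {x, y} \<in> E}\<^sup>* `` {v}"

definition connected_comps :: "'v set \<Rightarrow> 'v set set \<Rightarrow> 'v set set"
  where "connected_comps V E = connected_comp E ` V"

text \<open>The circles of \<open>W(b)a\<close>.\<close>

definition circles :: "nat \<Rightarrow> matching \<Rightarrow> matching \<Rightarrow> nat set set"
  where "circles n b a = connected_comps {1..2 * n} (b \<union> a)"


section \<open>The graded abelian group\<close>

definition b_OH_a :: "nat \<Rightarrow> matching \<times> matching \<Rightarrow> (nat set list \<Rightarrow>\<^sub>0 int) set ring"
  where "b_OH_a n = (\<lambda>(b, a). exterior_algebra (circles n b a))"

text \<open>The span of the wedges of \<open>k\<close> circles with \<open>2k + n - |W(b)a| = d\<close>.\<close>

definition b_OH_a_deg ::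
    "nat \<Rightarrow> matching \<times> matching \<Rightarrow> int \<Rightarrow> (nat set list \<Rightarrow>\<^sub>0 int) set set"
  where "b_OH_a_deg n = (\<lambda>(b, a) d. {exterior_class (circles n b a) t | t.
    t \<in> carrier (tensor_algebra (circles n b a)) \<and>
    (\<forall>w\<in>Poly_Mapping.keys t. 2 * int (length w) + int n - int (card (circles n b a)) = d)})"

type_synonym OH_elem = "matching \<times> matching \<Rightarrow> (nat set list \<Rightarrow>\<^sub>0 int) set"

definition OH_group :: "nat \<Rightarrow> OH_elem monoid"
  where "OH_group n =
    sum_group (crossingless_matchings n \<times> crossingless_matchings n) (\<lambda>p. add_monoid (b_OH_a n p))"

definition OH_deg :: "nat \<Rightarrow> int \<Rightarrow> OH_elem set"
  where "OH_deg n d = {x \<in> carrier (OH_group n).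
    \<forall>p\<in>crossingless_matchings n \<times> crossingless_matchings n. x p \<in> b_OH_a_deg n p d}"

text \<open>The element \<open>1\<^sub>a\<close> of the direct sum.\<close>

definition OH_idem :: "nat \<Rightarrow> matching \<Rightarrow> OH_elem"
  where "OH_idem n a = (\<lambda>p\<in>crossingless_matchings n \<times> crossingless_matchings n.
    if p = (a, a) then \<one>\<^bsub>b_OH_a n p\<^esub> else \<zero>\<^bsub>b_OH_a n p\<^esub>)"


section \<open>Multiplication rules\<close>

text \<open>\<open>(i, k) \<in> r\<close> means that \<open>i\<close> precedes or equals \<open>k\<close>.\<close>

definition rule_orders :: "nat \<Rightarrow> matching \<Rightarrow> nat rel set"
  where "rule_orders n b = {r. linear_order_on {1..2 * n} r \<and>
    (\<forall>i j k. {i, j} \<in> b \<and> i < k \<and> k < j \<longrightarrow> (i, k) \<in> r \<or> (j, k) \<in> r)}"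

text \<open>The value \<open>(i, j)\<close> at an arc stands for the orientation from \<open>i\<close> to \<open>j\<close>.\<close>

definition arc_orientations :: "matching \<Rightarrow> (nat set \<Rightarrow> nat \<times> nat) set"
  where "arc_orientations b = (\<Pi>\<^sub>E A\<in>b. {(i, j). {i, j} = A})"

type_synonym mult_rule =
  "matching \<times> matching \<times> matching \<Rightarrow> nat rel \<times> (nat set \<Rightarrow> nat \<times> nat)"

definition mult_rules :: "nat \<Rightarrow> mult_rule set"
  where "mult_rules n =
    (\<Pi>\<^sub>E (c, b, a)\<in>crossingless_matchings n \<times> crossingless_matchings n \<times> crossingless_matchings n.
      rule_orders n b \<times> arc_orientations b)"

definition enumerate_order :: "'v set \<Rightarrow> 'v rel \<Rightarrow> 'v list"
  where "enumerate_order A r =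
    (THE xs. set xs = A \<and> distinct xs \<and> sorted_wrt (\<lambda>x y. (x, y) \<in> r) xs)"


section \<open>Multiplication\<close>

datatype level = Upper | Lower

type_synonym vertex = "level \<times> nat"

text \<open>
  The diagram obtained from \<open>W(c)b\<close> placed above \<open>W(b)a\<close> by surgeries along the set \<open>P\<close> of arcs
  of \<open>b\<close>. Point \<open>i\<close> of \<open>W(c)b\<close> is \<open>(Upper, i)\<close>, and point \<open>i\<close> of \<open>W(b)a\<close> is \<open>(Lower, i)\<close>.
\<close>

definition diagram :: "matching \<Rightarrow> matching \<Rightarrow> matching \<Rightarrow> nat set set \<Rightarrow> vertex set set"
  where "diagram c b a P =
    (\<lambda>A. Pair Upper ` A) ` (c \<union> (b - P)) \<union> (\<lambda>A. Pair Lower ` A) ` ((b - P) \<union> a) \<union>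
    (\<lambda>i. {(Upper, i), (Lower, i)}) ` \<Union>P"

definition diagram_circles ::
    "nat \<Rightarrow> matching \<Rightarrow> matching \<Rightarrow> matching \<Rightarrow> nat set set \<Rightarrow> vertex set set"
  where "diagram_circles n c b a P = connected_comps (UNIV \<times> {1..2 * n}) (diagram c b a P)"

text \<open>
  The surgery along the arc \<open>{i, j}\<close>, oriented from \<open>i\<close> to \<open>j\<close>, after surgeries along the arcs
  in \<open>P\<close>. If the two copies of the arc lie on different circles, the surgery merges these circles.
  Otherwise it splits their common circle, as the diagrams are planar.
\<close>

definition surgery_map :: "nat \<Rightarrow> matching \<Rightarrow> matching \<Rightarrow> matching \<Rightarrow> nat set set \<Rightarrow> nat \<times> nat \<Rightarrow>
    (vertex set list \<Rightarrow>\<^sub>0 int) set \<Rightarrow> (vertex set list \<Rightarrow>\<^sub>0 int) set"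
  where "surgery_map n c b a P = (\<lambda>(i, j) x.
    let S2 = diagram_circles n c b a (insert {i, j} P);
        old = connected_comp (diagram c b a P);
        new = connected_comp (diagram c b a (insert {i, j} P));
        a1 = old (Upper, i); a2 = old (Lower, i)
    in if a1 \<noteq> a2
       then exterior_map S2 (\<lambda>s. if s = a1 \<or> s = a2 then new (Upper, i) else s) x
       else let e\<^sub>i = new (Upper, i); e\<^sub>j = new (Upper, j)
            in exterior_vec S2 (frag_of e\<^sub>i - frag_of e\<^sub>j)
               \<otimes>\<^bsub>exterior_algebra S2\<^esub> exterior_map S2 (\<lambda>s. if s = a1 then e\<^sub>i else s) x)"

fun surgeries :: "nat \<Rightarrow> matching \<Rightarrow> matching \<Rightarrow> matching \<Rightarrow> (nat set \<Rightarrow> nat \<times> nat) \<Rightarrow> nat list \<Rightarrow>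
    nat set set \<Rightarrow> (vertex set list \<Rightarrow>\<^sub>0 int) set \<Rightarrow> (vertex set list \<Rightarrow>\<^sub>0 int) set"
  where
    "surgeries n c b a ori [] P x = x"
  | "surgeries n c b a ori (p # ps) P x =
      (let A = (THE A. A \<in> b \<and> p \<in> A)
       in if A \<in> P then surgeries n c b a ori ps P x
          else surgeries n c b a ori ps (insert A P) (surgery_map n c b a P (ori A) x))"

text \<open>
  The product of \<open>x\<close> in \<open>c(OH)b\<close> and \<open>y\<close> in \<open>b(OH)a\<close>. After all surgeries both copies of a point
  lie on the same circle, and forgetting the levels identifies the circles with those of \<open>W(c)a\<close>.
\<close>

definition mult_cba :: "nat \<Rightarrow> mult_rule \<Rightarrow> matching \<Rightarrow> matching \<Rightarrow> matching \<Rightarrow>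
    (nat set list \<Rightarrow>\<^sub>0 int) set \<Rightarrow> (nat set list \<Rightarrow>\<^sub>0 int) set \<Rightarrow> (nat set list \<Rightarrow>\<^sub>0 int) set"
  where "mult_cba n C c b a x y =
    (let (r, ori) = C (c, b, a);
         D0 = diagram_circles n c b a {};
         xy = exterior_map D0 ((`) (Pair Upper)) x \<otimes>\<^bsub>exterior_algebra D0\<^esub>
              exterior_map D0 ((`) (Pair Lower)) y
     in exterior_map (circles n c a) ((`) snd)
          (surgeries n c b a ori (enumerate_order {1..2 * n} r) {} xy))"

text \<open>
  \<open>OH_group\<close> is written multiplicatively, so the product in the unit is the sum of all \<open>1\<^sub>a\<close>.
\<close>

definition OH :: "nat \<Rightarrow> mult_rule \<Rightarrow> OH_elem ring"
  where "OH n C =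
    \<lparr>carrier = carrier (OH_group n),
     monoid.mult = (\<lambda>x y. \<lambda>(c, a)\<in>crossingless_matchings n \<times> crossingless_matchings n.
       \<Oplus>\<^bsub>b_OH_a n (c, a)\<^esub>b\<in>crossingless_matchings n. mult_cba n C c b a (x (c, b)) (y (b, a))),
     one = finprod (OH_group n) (OH_idem n) (crossingless_matchings n),
     ring.zero = one (OH_group n),
     ring.add = monoid.mult (OH_group n)\<rparr>"

end

(*
  Proof idea. Surgering an arc replaces two edges of a union of two perfect matchings by two
  others. If the two copies of the arc lie on different circles, a parity count shows that each
  circle stays connected when it is cut open, so the surgery merges them; if they lie on the same
  circle, the two new circles together cover the old one. Hence every surgery map is well defined
  and additive, and it raises 2k - |circles| by exactly 1: in the degenerate case where nothing
  is split, the factor e_i - e_j vanishes. This gives a bilinear product of degree 0. In a product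
  with 1_a one of the two diagrams consists of n circles, one for each arc of a, so all surgeries
  are merges and their composite is the identity of exterior algebras.
*)
theory Submission
  imports Defs
begin

section \<open>Exterior algebras\<close>

text \<open>Two encodings shape the proof. Elements of an exterior algebra are cosets, and
  \<open>exterior_map\<close> reads its value off with \<open>the_elem\<close>, so it says nothing
  until all representatives are known to give the same class. This is settled once, in the locale
  \<open>exterior_induced\<close>, for two kinds of maps: those induced by maps of circles, and the
  projections to words of prescribed length. The projections exist because the exterior ideal is
  homogeneous, and they supply the direct sum decomposition of the graded ring. Circles are
  components of graphs. A diagram is read as the union of two perfect matchings of the doubled
  points: \<open>c\<close> above and \<open>a\<close> below, which no surgery touches, and the
  remaining copies of \<open>b\<close> together with the vertical segments. A surgery exchanges two
  edges of the second matching, and everything about merging, splitting and counting circles is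
  derived from such an exchange on an abstract finite vertex set.\<close>

lemma tensor_mult_frag_of: "tensor_mult (frag_of u) (frag_of v) = frag_of (u @ v)"
  by (simp add: tensor_mult_def)

lemma tensor_mult_diff_left: "tensor_mult (s - s') t = tensor_mult s t - tensor_mult s' t"
  by (simp add: tensor_mult_def frag_extend_diff)

lemma tensor_mult_add_left: "tensor_mult (s + s') t = tensor_mult s t + tensor_mult s' t"
  by (simp add: tensor_mult_def frag_extend_add)

lemma tensor_mult_0_left [simp]: "tensor_mult 0 t = 0"
  by (simp add: tensor_mult_def)

lemma tensor_mult_0_right [simp]: "tensor_mult s 0 = 0"
  by (simp add: tensor_mult_def frag_extend_eq_0)

text \<open>In the second argument the function that is extended varies, so linearity of
  \<open>frag_extend\<close> does not apply directly and the identity is checked on generators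
  \<open>s\<close>. Differences come before sums because \<open>frag_induction\<close> builds
  elements by subtraction.\<close>

lemma tensor_mult_diff_right: "tensor_mult s (t - t') = tensor_mult s t - tensor_mult s t'"
  using subset_UNIV
proof (induction s rule: frag_induction)
  case (one u)
  then show ?case by (simp add: tensor_mult_def frag_extend_diff)
qed (auto simp: tensor_mult_diff_left)

lemma tensor_mult_add_right: "tensor_mult s (t + t') = tensor_mult s t + tensor_mult s t'"
  using tensor_mult_diff_right[of s "t + t'" t'] by (simp add: algebra_simps)

lemma tensor_mult_assoc:
  "tensor_mult (tensor_mult s t) u = tensor_mult s (tensor_mult t u)"
  using subset_UNIV[of "Poly_Mapping.keys s"]
proof (induction s rule: frag_induction)
  case (one x)
  show ?case using subset_UNIV[of "Poly_Mapping.keys t"]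
  proof (induction t rule: frag_induction)
    case (one y)
    show ?case using subset_UNIV[of "Poly_Mapping.keys u"]
      by (induction u rule: frag_induction)
        (auto simp: tensor_mult_diff_right tensor_mult_frag_of)
  qed (auto simp: tensor_mult_diff_left tensor_mult_diff_right)
qed (auto simp: tensor_mult_diff_left)

lemma tensor_mult_Nil_left [simp]: "tensor_mult (frag_of []) t = t"
  using frag_expansion[of t] by (simp add: tensor_mult_def)

lemma tensor_mult_Nil_right [simp]: "tensor_mult t (frag_of []) = t"
  using subset_UNIV
  by (induction t rule: frag_induction) (auto simp: tensor_mult_diff_left tensor_mult_frag_of)

lemma keys_tensor_mult:
  "Poly_Mapping.keys (tensor_mult s t) \<subseteq>
    {u @ v | u v. u \<in> Poly_Mapping.keys s \<and> v \<in> Poly_Mapping.keys t}"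
  unfolding tensor_mult_def
  by (intro subset_trans[OF keys_frag_extend] UN_least)
     (use keys_frag_extend in fastforce)

section \<open>The tensor algebra of a set as a ring\<close>

lemma carrier_tensor_algebra [simp]:
  "t \<in> carrier (tensor_algebra S) \<longleftrightarrow> Poly_Mapping.keys t \<subseteq> lists S"
  by (simp add: tensor_algebra_def)

lemma tensor_algebra_simps [simp]:
  "s \<otimes>\<^bsub>tensor_algebra S\<^esub> t = tensor_mult s t" "s \<oplus>\<^bsub>tensor_algebra S\<^esub> t = s + t"
  "\<one>\<^bsub>tensor_algebra S\<^esub> = frag_of []" "\<zero>\<^bsub>tensor_algebra S\<^esub> = 0"
  by (simp_all add: tensor_algebra_def)

lemma keys_add_subset:
  "\<lbrakk>Poly_Mapping.keys s \<subseteq> A; Poly_Mapping.keys t \<subseteq> A\<rbrakk> \<Longrightarrow> Poly_Mapping.keys (s + t) \<subseteq> A"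
  using keys_add[of s t] by blast

lemma keys_diff_subset:
  "\<lbrakk>Poly_Mapping.keys s \<subseteq> A; Poly_Mapping.keys t \<subseteq> A\<rbrakk> \<Longrightarrow> Poly_Mapping.keys (s - t) \<subseteq> A"
  for s t :: "'a \<Rightarrow>\<^sub>0 int"
  using keys_diff[of s t] by blast

lemma tensor_mult_closed:
  "\<lbrakk>Poly_Mapping.keys s \<subseteq> lists S; Poly_Mapping.keys t \<subseteq> lists S\<rbrakk>
    \<Longrightarrow> Poly_Mapping.keys (tensor_mult s t) \<subseteq> lists S"
  using keys_tensor_mult[of s t] by fastforce

lemma ring_tensor_algebra: "ring (tensor_algebra S)"
proof (rule ringI)
  show "abelian_group (tensor_algebra S)"
  proof (rule abelian_groupI)
    fix x assume "x \<in> carrier (tensor_algebra S)"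
    then show "\<exists>y\<in>carrier (tensor_algebra S). y \<oplus>\<^bsub>tensor_algebra S\<^esub> x = \<zero>\<^bsub>tensor_algebra S\<^esub>"
      by (intro bexI[of _ "- x"]) auto
  qed (simp_all add: keys_add_subset algebra_simps)
  show "Group.monoid (tensor_algebra S)"
    by (rule monoidI) (simp_all add: tensor_mult_assoc tensor_mult_closed)
qed (auto simp: tensor_mult_add_left tensor_mult_add_right)

lemma tensor_vec_in: "Poly_Mapping.keys v \<subseteq> S \<Longrightarrow> Poly_Mapping.keys (tensor_vec v) \<subseteq> lists S"
  unfolding tensor_vec_def by (intro subset_trans[OF keys_frag_extend]) auto

lemma exterior_generators_in:
  "{tensor_mult (tensor_vec v) (tensor_vec v) | v. v \<in> carrier (free_Abelian_group S)}
    \<subseteq> carrier (tensor_algebra S)"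
proof
  fix x assume "x \<in> {tensor_mult (tensor_vec v) (tensor_vec v) | v. v \<in> carrier (free_Abelian_group S)}"
  then obtain v where "x = tensor_mult (tensor_vec v) (tensor_vec v)" "Poly_Mapping.keys v \<subseteq> S"
    by auto
  then show "x \<in> carrier (tensor_algebra S)"
    by (simp add: tensor_mult_closed tensor_vec_in)
qed

section \<open>Working with the exterior ideal\<close>

lemma ideal_exterior_ideal: "ideal (exterior_ideal S) (tensor_algebra S)"
  unfolding exterior_ideal_def
  by (rule ring.genideal_ideal[OF ring_tensor_algebra exterior_generators_in])

text \<open>Minimality of the generated ideal. Both facts about maps preserving exterior ideals are
  proved with it: the elements with a good image form an ideal that contains the squares.\<close>

lemma exterior_ideal_subset:
  assumes "ideal J (tensor_algebra S)"
    and "\<And>v. Poly_Mapping.keys v \<subseteq> S \<Longrightarrow> tensor_mult (tensor_vec v) (tensor_vec v) \<in> J"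
  shows "exterior_ideal S \<subseteq> J"
  unfolding exterior_ideal_def
  by (rule ring.genideal_minimal[OF ring_tensor_algebra assms(1)]) (use assms(2) in auto)

lemma exterior_ideal_square:
  "Poly_Mapping.keys v \<subseteq> S \<Longrightarrow> tensor_mult (tensor_vec v) (tensor_vec v) \<in> exterior_ideal S"
  unfolding exterior_ideal_def
  using ring.genideal_self[OF ring_tensor_algebra exterior_generators_in[of S]] by auto

lemma exterior_ideal_carrier:
  "t \<in> exterior_ideal S \<Longrightarrow> Poly_Mapping.keys t \<subseteq> lists S"
  using ideal.Icarr[OF ideal_exterior_ideal] by (metis carrier_tensor_algebra)

lemma exterior_ideal_0 [simp]: "0 \<in> exterior_ideal S"
  using additive_subgroup.zero_closed[OF ideal.axioms(1)[OF ideal_exterior_ideal[of S]]] by simp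

lemma exterior_ideal_add:
  "\<lbrakk>s \<in> exterior_ideal S; t \<in> exterior_ideal S\<rbrakk> \<Longrightarrow> s + t \<in> exterior_ideal S"
  using additive_subgroup.a_closed[OF ideal.axioms(1)[OF ideal_exterior_ideal[of S]]] by simp

lemma exterior_ideal_mult:
  assumes "t \<in> exterior_ideal S" "Poly_Mapping.keys s \<subseteq> lists S"
  shows "tensor_mult s t \<in> exterior_ideal S" "tensor_mult t s \<in> exterior_ideal S"
  using ideal.I_l_closed[OF ideal_exterior_ideal[of S], of t s]
    ideal.I_r_closed[OF ideal_exterior_ideal[of S], of t s] assms by auto

text \<open>Negation is multiplication by the scalar \<open>- frag_of []\<close>, so absorption
  suffices.\<close>

lemma exterior_ideal_minus:
  assumes "t \<in> exterior_ideal S" shows "- t \<in> exterior_ideal S"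
proof -
  have "tensor_mult (- frag_of []) t \<in> exterior_ideal S"
    by (rule exterior_ideal_mult[OF assms]) auto
  moreover have "tensor_mult (- frag_of []) t = - t"
    using tensor_mult_diff_left[of 0 "frag_of []" t] by simp
  ultimately show ?thesis by simp
qed

text \<open>A criterion that does not mention negation, which is recovered as in
  \<open>exterior_ideal_minus\<close>.\<close>

lemma ideal_tensor_algebraI:
  assumes sub: "\<And>t. t \<in> J \<Longrightarrow> Poly_Mapping.keys t \<subseteq> lists S"
    and "0 \<in> J"
    and add: "\<And>s t. \<lbrakk>s \<in> J; t \<in> J\<rbrakk> \<Longrightarrow> s + t \<in> J"
    and l: "\<And>s t. \<lbrakk>t \<in> J; Poly_Mapping.keys s \<subseteq> lists S\<rbrakk> \<Longrightarrow> tensor_mult s t \<in> J"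
    and r: "\<And>s t. \<lbrakk>t \<in> J; Poly_Mapping.keys s \<subseteq> lists S\<rbrakk> \<Longrightarrow> tensor_mult t s \<in> J"
  shows "ideal J (tensor_algebra S)"
proof (rule idealI[OF ring_tensor_algebra])
  interpret ring "tensor_algebra S" by (rule ring_tensor_algebra)
  have m: "- t \<in> J" if "t \<in> J" for t
    using l[OF that, of "- frag_of []"] tensor_mult_diff_left[of 0 "frag_of []" t] by simp
  have neg: "\<ominus>\<^bsub>tensor_algebra S\<^esub> t = - t" if "t \<in> J" for t
    using sub[OF that] by (intro minus_equality) auto
  show "subgroup J (add_monoid (tensor_algebra S))"
    by (rule group.subgroupI[OF a_group])
       (use assms m neg in \<open>auto simp: a_inv_def\<close>)
qed (use l r in auto)

section \<open>The exterior algebra as a ring of cosets\<close>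

lemma ring_exterior_algebra: "ring (exterior_algebra S)"
  unfolding exterior_algebra_def by (rule ideal.quotient_is_ring[OF ideal_exterior_ideal])

lemma exterior_class_def': "exterior_class S t = (\<lambda>i. i + t) ` exterior_ideal S"
  by (auto simp: exterior_class_def a_r_coset_def r_coset_def)

lemma exterior_class_closed [simp]:
  "Poly_Mapping.keys t \<subseteq> lists S \<Longrightarrow> exterior_class S t \<in> carrier (exterior_algebra S)"
  unfolding exterior_class_def exterior_algebra_def FactRing_def
  by (auto simp: A_RCOSETS_def RCOSETS_def a_r_coset_def)

lemma exterior_algebra_cases:
  assumes "X \<in> carrier (exterior_algebra S)"
  obtains t where "Poly_Mapping.keys t \<subseteq> lists S" "X = exterior_class S t"
  using assms unfolding exterior_class_def exterior_algebra_def FactRing_def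
  by (auto simp: A_RCOSETS_def RCOSETS_def a_r_coset_def)

lemma exterior_class_ring_hom:
  "exterior_class S \<in> ring_hom (tensor_algebra S) (exterior_algebra S)"
  using ideal.rcos_ring_hom[OF ideal_exterior_ideal[of S]]
  unfolding exterior_algebra_def by (simp add: exterior_class_def[abs_def])

lemma exterior_class_add:
  "\<lbrakk>Poly_Mapping.keys s \<subseteq> lists S; Poly_Mapping.keys t \<subseteq> lists S\<rbrakk>
    \<Longrightarrow> exterior_class S s \<oplus>\<^bsub>exterior_algebra S\<^esub> exterior_class S t = exterior_class S (s + t)"
  using ring_hom_add[OF exterior_class_ring_hom[of S], of s t] by simp

lemma exterior_class_mult:
  "\<lbrakk>Poly_Mapping.keys s \<subseteq> lists S; Poly_Mapping.keys t \<subseteq> lists S\<rbrakk>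
    \<Longrightarrow> exterior_class S s \<otimes>\<^bsub>exterior_algebra S\<^esub> exterior_class S t =
      exterior_class S (tensor_mult s t)"
  using ring_hom_mult[OF exterior_class_ring_hom[of S], of s t] by simp

lemma exterior_algebra_one: "\<one>\<^bsub>exterior_algebra S\<^esub> = exterior_class S (frag_of [])"
  using ring_hom_one[OF exterior_class_ring_hom[of S]] by simp

lemma exterior_algebra_zero: "\<zero>\<^bsub>exterior_algebra S\<^esub> = exterior_class S 0"
  by (simp add: exterior_algebra_def FactRing_def exterior_class_def')

lemma exterior_class_eqI:
  assumes "s - t \<in> exterior_ideal S"
  shows "exterior_class S s = exterior_class S t"
proof -
  have "i + s \<in> (\<lambda>i. i + t) ` exterior_ideal S" if "i \<in> exterior_ideal S" for i
    by (rule image_eqI[of _ _ "i + (s - t)"]) (use that assms exterior_ideal_add in auto)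
  moreover have "i + t \<in> (\<lambda>i. i + s) ` exterior_ideal S" if "i \<in> exterior_ideal S" for i
    by (rule image_eqI[of _ _ "i + - (s - t)"])
       (use that exterior_ideal_add exterior_ideal_minus[OF assms] in auto)
  ultimately show ?thesis unfolding exterior_class_def' by blast
qed


subsection \<open>Induced additive maps\<close>

text \<open>More general than \<open>exterior_map\<close>: the map on representatives need not be
  multiplicative, so the projections to words of prescribed length are covered as well.\<close>

definition induced_map ::
    "'d set \<Rightarrow> (('c list \<Rightarrow>\<^sub>0 int) \<Rightarrow> ('d list \<Rightarrow>\<^sub>0 int)) \<Rightarrow>
      ('c list \<Rightarrow>\<^sub>0 int) set \<Rightarrow> ('d list \<Rightarrow>\<^sub>0 int) set"
  where "induced_map S \<phi> X = the_elem ((\<lambda>t. exterior_class S (\<phi> t)) ` X)"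

text \<open>The conditions that make \<open>induced_map\<close> independent of the representative.
  \<open>f\<close> is given on words rather than on letters in order to include
  \<open>length_part\<close>.\<close>

locale exterior_induced =
  fixes S :: "'c set" and S' :: "'d set"
    and f :: "'c list \<Rightarrow> 'd list \<Rightarrow>\<^sub>0 int"
  assumes closed: "w \<in> lists S \<Longrightarrow> Poly_Mapping.keys (f w) \<subseteq> lists S'"
    and ideal: "t \<in> exterior_ideal S \<Longrightarrow> frag_extend f t \<in> exterior_ideal S'"
begin

lemma extend_closed:
  "Poly_Mapping.keys t \<subseteq> lists S \<Longrightarrow> Poly_Mapping.keys (frag_extend f t) \<subseteq> lists S'"
  by (rule subset_trans[OF keys_frag_extend]) (use closed in blast)

lemma induced_map_class:
  assumes "Poly_Mapping.keys t \<subseteq> lists S"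
  shows "induced_map S' (frag_extend f) (exterior_class S t) = exterior_class S' (frag_extend f t)"
proof -
  have "exterior_class S' (frag_extend f (i + t)) = exterior_class S' (frag_extend f t)"
    if "i \<in> exterior_ideal S" for i
    by (rule exterior_class_eqI) (simp add: frag_extend_add ideal[OF that])
  then have "(\<lambda>t. exterior_class S' (frag_extend f t)) ` exterior_class S t
      = {exterior_class S' (frag_extend f t)}"
    unfolding exterior_class_def'[of S] image_image
    \<comment> \<open>The representative \<open>0 + t\<close> shows that the image is not empty,
      hence a singleton.\<close>
    by (auto intro!: image_eqI[of _ _ "0 :: 'c list \<Rightarrow>\<^sub>0 int"])
  then show ?thesis by (simp add: induced_map_def)
qed

lemma induced_map_hom:
  "induced_map S' (frag_extend f)
    \<in> hom (add_monoid (exterior_algebra S)) (add_monoid (exterior_algebra S'))"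
  by (rule homI)
     (auto elim!: exterior_algebra_cases
       simp: induced_map_class exterior_class_add extend_closed keys_add_subset frag_extend_add)

end


subsection \<open>Functoriality\<close>

lemma tensor_map_mult:
  "frag_extend (\<lambda>w. frag_of (map f w)) (tensor_mult s t) =
    tensor_mult (frag_extend (\<lambda>w. frag_of (map f w)) s) (frag_extend (\<lambda>w. frag_of (map f w)) t)"
  using subset_UNIV[of "Poly_Mapping.keys s"]
proof (induction s rule: frag_induction)
  case (one u)
  show ?case using subset_UNIV[of "Poly_Mapping.keys t"]
    by (induction t rule: frag_induction)
       (auto simp: frag_extend_diff tensor_mult_diff_right tensor_mult_frag_of)
qed (auto simp: frag_extend_diff tensor_mult_diff_left)

lemma tensor_map_vec:
  "frag_extend (\<lambda>w. frag_of (map f w)) (tensor_vec v) = tensor_vec (frag_extend (\<lambda>s. frag_of (f s)) v)"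
  using subset_UNIV
  by (induction v rule: frag_induction) (auto simp: tensor_vec_def frag_extend_diff)

text \<open>The preimage of the exterior ideal of \<open>S'\<close> is an ideal. It contains all
  squares of vectors because the word map is multiplicative and takes vectors to vectors, also when
  \<open>f\<close> identifies circles.\<close>

lemma exterior_induced_map:
  assumes "f ` S \<subseteq> S'"
  shows "exterior_induced S S' (\<lambda>w. frag_of (map f w))"
proof
  let ?\<phi> = "frag_extend (\<lambda>w. frag_of (map f w))"
  show cl: "Poly_Mapping.keys (frag_of (map f w)) \<subseteq> lists S'" if "w \<in> lists S" for w
    using that assms by (auto simp: image_subset_iff)
  have cl': "Poly_Mapping.keys (?\<phi> t) \<subseteq> lists S'" if "Poly_Mapping.keys t \<subseteq> lists S" for t
    by (rule subset_trans[OF keys_frag_extend]) (use cl that in blast)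
  have "ideal {t. Poly_Mapping.keys t \<subseteq> lists S \<and> ?\<phi> t \<in> exterior_ideal S'} (tensor_algebra S)"
    by (rule ideal_tensor_algebraI)
       (simp_all add: cl' keys_add_subset frag_extend_add tensor_map_mult tensor_mult_closed
          exterior_ideal_add exterior_ideal_mult)
  then have "exterior_ideal S \<subseteq> {t. Poly_Mapping.keys t \<subseteq> lists S \<and> ?\<phi> t \<in> exterior_ideal S'}"
  proof (rule exterior_ideal_subset)
    fix v :: "'b \<Rightarrow>\<^sub>0 int" assume v: "Poly_Mapping.keys v \<subseteq> S"
    have "Poly_Mapping.keys (frag_extend (\<lambda>s. frag_of (f s)) v) \<subseteq> S'"
      by (rule subset_trans[OF keys_frag_extend]) (use v assms in auto)
    then show "tensor_mult (tensor_vec v) (tensor_vec v)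
        \<in> {t. Poly_Mapping.keys t \<subseteq> lists S \<and> ?\<phi> t \<in> exterior_ideal S'}"
      using tensor_mult_closed[OF tensor_vec_in[OF v] tensor_vec_in[OF v]]
      by (simp add: tensor_map_mult tensor_map_vec exterior_ideal_square)
  qed
  then show "?\<phi> t \<in> exterior_ideal S'" if "t \<in> exterior_ideal S" for t
    using that by blast
qed

lemma exterior_map_eq_induced:
  "exterior_map S' f = induced_map S' (frag_extend (\<lambda>w. frag_of (map f w)))"
  by (simp add: fun_eq_iff exterior_map_def induced_map_def)

lemma exterior_map_class:
  assumes "f ` S \<subseteq> S'" "Poly_Mapping.keys t \<subseteq> lists S"
  shows "exterior_map S' f (exterior_class S t) =
    exterior_class S' (frag_extend (\<lambda>w. frag_of (map f w)) t)"
  unfolding exterior_map_eq_induced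
  by (rule exterior_induced.induced_map_class[OF exterior_induced_map[OF assms(1)] assms(2)])

lemma exterior_map_hom:
  "f ` S \<subseteq> S' \<Longrightarrow>
    exterior_map S' f \<in> hom (add_monoid (exterior_algebra S)) (add_monoid (exterior_algebra S'))"
  unfolding exterior_map_eq_induced
  by (rule exterior_induced.induced_map_hom[OF exterior_induced_map])

lemma exterior_map_one:
  "f ` S \<subseteq> S' \<Longrightarrow> exterior_map S' f \<one>\<^bsub>exterior_algebra S\<^esub> = \<one>\<^bsub>exterior_algebra S'\<^esub>"
  by (simp add: exterior_algebra_one exterior_map_class)

lemma keys_tensor_map:
  assumes "f ` S \<subseteq> S'" "Poly_Mapping.keys t \<subseteq> lists S"
  shows "Poly_Mapping.keys (frag_extend (\<lambda>w. frag_of (map f w)) t) \<subseteq> lists S'"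
  by (rule exterior_induced.extend_closed[OF exterior_induced_map[OF assms(1)] assms(2)])

text \<open>The composite is compared with \<open>h\<close> on \<open>S\<close> only, since maps of
  circles are written as functions on arbitrary sets and have a meaning only on circles.\<close>

lemma exterior_map_comp:
  assumes "f ` S \<subseteq> S'" "g ` S' \<subseteq> S''" "X \<in> carrier (exterior_algebra S)"
    and h: "\<And>s. s \<in> S \<Longrightarrow> g (f s) = h s"
  shows "exterior_map S'' g (exterior_map S' f X) = exterior_map S'' h X"
  using assms(3)
proof (rule exterior_algebra_cases)
  fix t assume t: "Poly_Mapping.keys t \<subseteq> lists S" "X = exterior_class S t"
  have "h ` S \<subseteq> S''" using assms(1,2) h by force
  moreover have "frag_extend (\<lambda>w. frag_of (map g w)) (frag_extend (\<lambda>w. frag_of (map f w)) t)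
      = frag_extend (\<lambda>w. frag_of (map h w)) t" using t(1)
  proof (induction t rule: frag_induction)
    case (one w)
    then have "map g (map f w) = map h w" using h by auto
    then show ?case by (simp del: map_map)
  qed (auto simp: frag_extend_diff)
  ultimately show ?thesis
    using assms(1,2) t by (simp add: exterior_map_class keys_tensor_map)
qed

lemma exterior_map_id:
  assumes "X \<in> carrier (exterior_algebra S)" "\<And>s. s \<in> S \<Longrightarrow> f s = s"
  shows "exterior_map S f X = X"
  using assms(1)
proof (rule exterior_algebra_cases)
  fix t assume t: "Poly_Mapping.keys t \<subseteq> lists S" "X = exterior_class S t"
  have "f ` S \<subseteq> S" using assms(2) by auto
  moreover have "frag_extend (\<lambda>w. frag_of (map f w)) t = t" using t(1)
  proof (induction t rule: frag_induction)
    case (one w)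
    then have "map f w = w" using assms(2) by (intro map_idI) auto
    then show ?case by simp
  qed (auto simp: frag_extend_diff)
  ultimately show ?thesis using t by (simp add: exterior_map_class)
qed


subsection \<open>Grading by length\<close>

text \<open>A predicate on the length, instead of a number, allows conditions such as
  \<open>2 * int k - int (card S) = d\<close> without solving for \<open>k\<close>. If no length
  satisfies it, the part is zero.\<close>

definition exterior_part :: "'c set \<Rightarrow> (nat \<Rightarrow> bool) \<Rightarrow> ('c list \<Rightarrow>\<^sub>0 int) set set"
  where "exterior_part S Q = {exterior_class S t | t.
    Poly_Mapping.keys t \<subseteq> lists S \<and> (\<forall>w\<in>Poly_Mapping.keys t. Q (length w))}"

text \<open>Its extension by \<open>frag_extend\<close> is the projection of the tensor algebra onto
  the span of the words whose length satisfies \<open>Q\<close>.\<close>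

definition length_part :: "(nat \<Rightarrow> bool) \<Rightarrow> 'c list \<Rightarrow> 'c list \<Rightarrow>\<^sub>0 int"
  where "length_part Q w = (if Q (length w) then frag_of w else 0)"

text \<open>A factor \<open>u\<close> shifts all lengths by \<open>length u\<close>, so a projection
  passes through it at the price of shifting the predicate.\<close>

lemma length_part_mult_frag_of:
  "frag_extend (length_part Q) (tensor_mult (frag_of u) t) =
    tensor_mult (frag_of u) (frag_extend (length_part (\<lambda>k. Q (length u + k))) t)"
  "frag_extend (length_part Q) (tensor_mult t (frag_of u)) =
    tensor_mult (frag_extend (length_part (\<lambda>k. Q (k + length u))) t) (frag_of u)"
  using subset_UNIV[of "Poly_Mapping.keys t"]
  by (induction t rule: frag_induction)
     (auto simp: frag_extend_diff tensor_mult_diff_right tensor_mult_diff_left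
       tensor_mult_frag_of length_part_def)

lemma length_part_id:
  "(\<And>w. w \<in> Poly_Mapping.keys t \<Longrightarrow> Q (length w)) \<Longrightarrow> frag_extend (length_part Q) t = t"
  using frag_extend_eq[of t "length_part Q" frag_of] frag_expansion[of t]
  by (simp add: length_part_def)

lemma length_part_0:
  "(\<And>w. w \<in> Poly_Mapping.keys t \<Longrightarrow> \<not> Q (length w)) \<Longrightarrow> frag_extend (length_part Q) t = 0"
  by (rule frag_extend_eq_0) (simp add: length_part_def)

lemma keys_length_part:
  "w \<in> Poly_Mapping.keys (frag_extend (length_part Q) t) \<Longrightarrow> w \<in> Poly_Mapping.keys t \<and> Q (length w)"
  using keys_frag_extend[of "length_part Q" t] by (auto simp: length_part_def split: if_splits)

lemma length_square:
  assumes "w \<in> Poly_Mapping.keys (tensor_mult (tensor_vec v) (tensor_vec v))"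
  shows "length w = 2"
proof -
  have "length u = 1" if "u \<in> Poly_Mapping.keys (tensor_vec v)" for u
    using that keys_frag_extend[of "\<lambda>s. frag_of [s]" v] by (auto simp: tensor_vec_def)
  then show ?thesis using assms keys_tensor_mult by fastforce
qed

text \<open>The exterior ideal is homogeneous, as its generators are.\<close>

lemma exterior_induced_length_part: "exterior_induced S S (length_part Q)"
proof
  show "Poly_Mapping.keys (length_part Q w) \<subseteq> lists S" if "w \<in> lists S" for w
    using that by (auto simp: length_part_def)
  \<comment> \<open>All predicates are required at once, because absorbing a word replaces the
    predicate by a shifted one.\<close>
  define J where "J = {t. Poly_Mapping.keys t \<subseteq> lists S \<and>
      (\<forall>Q. frag_extend (length_part Q) t \<in> exterior_ideal S)}"
  have mult: "tensor_mult s t \<in> J \<and> tensor_mult t s \<in> J"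
    if t: "t \<in> J" and "Poly_Mapping.keys s \<subseteq> lists S" for s t
  proof -
    have "frag_extend (length_part Q) (tensor_mult s t) \<in> exterior_ideal S \<and>
        frag_extend (length_part Q) (tensor_mult t s) \<in> exterior_ideal S" for Q
      using that(2)
    proof (induction s rule: frag_induction)
      case (one u)
      then have "Poly_Mapping.keys (frag_of u) \<subseteq> lists S" by simp
      then show ?case using t
        by (simp add: length_part_mult_frag_of J_def exterior_ideal_mult)
    next
      case (diff a b)
      have "x - y \<in> exterior_ideal S" if "x \<in> exterior_ideal S" "y \<in> exterior_ideal S" for x y
        using exterior_ideal_add[OF that(1) exterior_ideal_minus[OF that(2)]] by simp
      then show ?case using diff
        by (auto simp: frag_extend_diff tensor_mult_diff_right tensor_mult_diff_left)
    qed auto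
    then show ?thesis
      using that tensor_mult_closed[of s S t] tensor_mult_closed[of t S s] by (auto simp: J_def)
  qed
  have "ideal J (tensor_algebra S)"
  proof (rule ideal_tensor_algebraI)
    show "s + t \<in> J" if "s \<in> J" "t \<in> J" for s t
      using that by (simp add: J_def frag_extend_add exterior_ideal_add keys_add_subset)
  qed (use mult in \<open>auto simp: J_def\<close>)
  then have "exterior_ideal S \<subseteq> J"
  proof (rule exterior_ideal_subset)
    fix v :: "'a \<Rightarrow>\<^sub>0 int" assume v: "Poly_Mapping.keys v \<subseteq> S"
    let ?g = "tensor_mult (tensor_vec v) (tensor_vec v)"
    \<comment> \<open>A homogeneous element is either fixed or killed by each projection.\<close>
    have "frag_extend (length_part Q) ?g \<in> {0, ?g}" for Q
      using length_part_id[of ?g Q] length_part_0[of ?g Q] length_square[of _ v]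
      by (cases "Q 2") auto
    then show "?g \<in> J"
      using exterior_ideal_square[OF v] exterior_ideal_carrier[OF exterior_ideal_square[OF v]]
      by (auto simp: J_def) (metis (no_types, lifting) exterior_ideal_0 insertE singletonD)
  qed
  then show "frag_extend (length_part Q) t \<in> exterior_ideal S" if "t \<in> exterior_ideal S" for t
    using that by (auto simp: J_def)
qed

definition exterior_proj :: "'c set \<Rightarrow> (nat \<Rightarrow> bool) \<Rightarrow> ('c list \<Rightarrow>\<^sub>0 int) set \<Rightarrow> ('c list \<Rightarrow>\<^sub>0 int) set"
  where "exterior_proj S Q = induced_map S (frag_extend (length_part Q))"

lemma exterior_proj_class:
  "Poly_Mapping.keys t \<subseteq> lists S \<Longrightarrow>
    exterior_proj S Q (exterior_class S t) = exterior_class S (frag_extend (length_part Q) t)"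
  unfolding exterior_proj_def
  by (rule exterior_induced.induced_map_class[OF exterior_induced_length_part])

lemma exterior_proj_hom:
  "exterior_proj S Q \<in> hom (add_monoid (exterior_algebra S)) (add_monoid (exterior_algebra S))"
  unfolding exterior_proj_def
  by (rule exterior_induced.induced_map_hom[OF exterior_induced_length_part])

lemma exterior_partI:
  "\<lbrakk>Poly_Mapping.keys t \<subseteq> lists S; \<And>w. w \<in> Poly_Mapping.keys t \<Longrightarrow> Q (length w)\<rbrakk>
    \<Longrightarrow> exterior_class S t \<in> exterior_part S Q"
  by (auto simp: exterior_part_def)

lemma exterior_partE:
  assumes "X \<in> exterior_part S Q"
  obtains t where "Poly_Mapping.keys t \<subseteq> lists S" "\<And>w. w \<in> Poly_Mapping.keys t \<Longrightarrow> Q (length w)"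
    "X = exterior_class S t"
  using assms by (auto simp: exterior_part_def)

lemma exterior_part_carrier: "X \<in> exterior_part S Q \<Longrightarrow> X \<in> carrier (exterior_algebra S)"
  by (auto elim!: exterior_partE)

lemma exterior_proj_part:
  assumes "X \<in> carrier (exterior_algebra S)"
  shows "exterior_proj S Q X \<in> exterior_part S Q"
  using assms
  by (elim exterior_algebra_cases)
     (auto simp: exterior_proj_class dest: keys_length_part intro!: exterior_partI)

lemma exterior_proj_id: "X \<in> exterior_part S Q \<Longrightarrow> exterior_proj S Q X = X"
  by (elim exterior_partE) (simp add: exterior_proj_class length_part_id)

lemma exterior_proj_other:
  assumes "X \<in> exterior_part S Q" "\<And>k. Q k \<Longrightarrow> \<not> Q' k"
  shows "exterior_proj S Q' X = \<zero>\<^bsub>exterior_algebra S\<^esub>"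
  using assms
  by (elim exterior_partE) (simp add: exterior_proj_class length_part_0 exterior_algebra_zero)

lemma exterior_part_zero: "\<zero>\<^bsub>exterior_algebra S\<^esub> \<in> exterior_part S Q"
  unfolding exterior_algebra_zero by (rule exterior_partI) auto

lemma exterior_part_add:
  assumes "X \<in> exterior_part S Q" "Y \<in> exterior_part S Q"
  shows "X \<oplus>\<^bsub>exterior_algebra S\<^esub> Y \<in> exterior_part S Q"
proof -
  obtain s t where s: "Poly_Mapping.keys s \<subseteq> lists S" "\<And>w. w \<in> Poly_Mapping.keys s \<Longrightarrow> Q (length w)"
      "X = exterior_class S s"
    and t: "Poly_Mapping.keys t \<subseteq> lists S" "\<And>w. w \<in> Poly_Mapping.keys t \<Longrightarrow> Q (length w)"
      "Y = exterior_class S t"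
    using assms by (metis exterior_partE)
  have "exterior_class S (s + t) \<in> exterior_part S Q"
    using s(1,2) t(1,2) keys_add[of s t] by (intro exterior_partI keys_add_subset) blast+
  then show ?thesis using s t by (simp add: exterior_class_add)
qed

lemma exterior_part_minus:
  assumes "X \<in> exterior_part S Q"
  shows "\<ominus>\<^bsub>exterior_algebra S\<^esub> X \<in> exterior_part S Q"
proof -
  obtain t where t: "Poly_Mapping.keys t \<subseteq> lists S" "\<And>w. w \<in> Poly_Mapping.keys t \<Longrightarrow> Q (length w)"
      "X = exterior_class S t"
    using assms by (metis exterior_partE)
  interpret ring "exterior_algebra S" by (rule ring_exterior_algebra)
  have "\<ominus>\<^bsub>exterior_algebra S\<^esub> X = exterior_class S (- t)"
    using t by (intro minus_equality) (simp_all add: exterior_class_add exterior_algebra_zero)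
  moreover have "exterior_class S (- t) \<in> exterior_part S Q"
    using t by (intro exterior_partI) auto
  ultimately show ?thesis using t by simp
qed

lemma exterior_part_mult:
  assumes "X \<in> exterior_part S Q" "Y \<in> exterior_part S Q'"
    and Q'': "\<And>k l. \<lbrakk>Q k; Q' l\<rbrakk> \<Longrightarrow> Q'' (k + l)"
  shows "X \<otimes>\<^bsub>exterior_algebra S\<^esub> Y \<in> exterior_part S Q''"
proof -
  obtain s t where s: "Poly_Mapping.keys s \<subseteq> lists S" "\<And>w. w \<in> Poly_Mapping.keys s \<Longrightarrow> Q (length w)"
      "X = exterior_class S s"
    and t: "Poly_Mapping.keys t \<subseteq> lists S" "\<And>w. w \<in> Poly_Mapping.keys t \<Longrightarrow> Q' (length w)"
      "Y = exterior_class S t"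
    using assms(1,2) by (metis exterior_partE)
  have "exterior_class S (tensor_mult s t) \<in> exterior_part S Q''"
  proof (intro exterior_partI tensor_mult_closed)
    fix w assume "w \<in> Poly_Mapping.keys (tensor_mult s t)"
    then obtain u v where "w = u @ v" "u \<in> Poly_Mapping.keys s" "v \<in> Poly_Mapping.keys t"
      using keys_tensor_mult by blast
    then show "Q'' (length w)" using s(2) t(2) Q'' by simp
  qed (use s t in auto)
  then show ?thesis using s t by (simp add: exterior_class_mult)
qed

lemma exterior_map_part:
  assumes "X \<in> exterior_part S Q" "f ` S \<subseteq> S'"
  shows "exterior_map S' f X \<in> exterior_part S' Q"
proof -
  obtain t where t: "Poly_Mapping.keys t \<subseteq> lists S" "\<And>w. w \<in> Poly_Mapping.keys t \<Longrightarrow> Q (length w)"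
      "X = exterior_class S t"
    using assms by (metis exterior_partE)
  have "exterior_class S' (frag_extend (\<lambda>w. frag_of (map f w)) t) \<in> exterior_part S' Q"
  proof (intro exterior_partI keys_tensor_map[OF assms(2) t(1)])
    fix w assume "w \<in> Poly_Mapping.keys (frag_extend (\<lambda>w. frag_of (map f w)) t)"
    then show "Q (length w)" using keys_frag_extend[of "\<lambda>w. frag_of (map f w)" t] t(2) by fastforce
  qed
  then show ?thesis using t assms by (simp add: exterior_map_class)
qed

lemma exterior_part_mono:
  "\<lbrakk>X \<in> exterior_part S Q; \<And>k. Q k \<Longrightarrow> Q' k\<rbrakk> \<Longrightarrow> X \<in> exterior_part S Q'"
  by (auto simp: exterior_part_def)

lemma exterior_part_one: "Q 0 \<Longrightarrow> \<one>\<^bsub>exterior_algebra S\<^esub> \<in> exterior_part S Q"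
  unfolding exterior_algebra_one by (rule exterior_partI) auto

lemma exterior_vec_part:
  "\<lbrakk>Poly_Mapping.keys v \<subseteq> S; Q 1\<rbrakk> \<Longrightarrow> exterior_vec S v \<in> exterior_part S Q"
  unfolding exterior_vec_def
  by (rule exterior_partI)
     (use tensor_vec_in[of v S] keys_frag_extend[of "\<lambda>s. frag_of [s]" v] in \<open>auto simp: tensor_vec_def\<close>)

lemma exterior_vec_0: "exterior_vec S 0 = \<zero>\<^bsub>exterior_algebra S\<^esub>"
  by (simp add: exterior_vec_def exterior_algebra_zero tensor_vec_def)

lemma exterior_class_sum:
  assumes "finite D" "\<And>d. d \<in> D \<Longrightarrow> Poly_Mapping.keys (t d) \<subseteq> lists S"
  shows "exterior_class S (\<Sum>d\<in>D. t d) = (\<Oplus>\<^bsub>exterior_algebra S\<^esub>d\<in>D. exterior_class S (t d))"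
  using assms
proof (induction D rule: finite_induct)
  interpret ring "exterior_algebra S" by (rule ring_exterior_algebra)
  case (insert d D)
  have "Poly_Mapping.keys (\<Sum>d\<in>D. t d) \<subseteq> lists S"
    using keys_sum[of t D] insert.prems by blast
  then have "exterior_class S (\<Sum>d\<in>insert d D. t d) =
      exterior_class S (t d) \<oplus>\<^bsub>exterior_algebra S\<^esub> exterior_class S (\<Sum>d\<in>D. t d)"
    using insert.hyps insert.prems by (simp add: exterior_class_add)
  moreover have "(\<Oplus>\<^bsub>exterior_algebra S\<^esub>d\<in>insert d D. exterior_class S (t d)) =
      exterior_class S (t d) \<oplus>\<^bsub>exterior_algebra S\<^esub> (\<Oplus>\<^bsub>exterior_algebra S\<^esub>d\<in>D. exterior_class S (t d))"
    using insert.hyps insert.prems by (intro finsum_insert) auto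
  ultimately show ?case using insert.IH insert.prems by simp
next
  case empty
  interpret ring "exterior_algebra S" by (rule ring_exterior_algebra)
  show ?case by (simp add: exterior_algebra_zero)
qed

text \<open>The degrees of the words in one representative form a suitable \<open>D\<close>. The sum
  may be taken over any larger finite set, so that several elements can later share one index
  set.\<close>

lemma exterior_decomposition:
  fixes g :: "nat \<Rightarrow> int"
  assumes "X \<in> carrier (exterior_algebra S)"
  obtains D where "finite D"
    "\<And>d. d \<notin> D \<Longrightarrow> exterior_proj S (\<lambda>k. g k = d) X = \<zero>\<^bsub>exterior_algebra S\<^esub>"
    "\<And>E. \<lbrakk>finite E; D \<subseteq> E\<rbrakk> \<Longrightarrow>
      X = (\<Oplus>\<^bsub>exterior_algebra S\<^esub>d\<in>E. exterior_proj S (\<lambda>k. g k = d) X)"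
proof -
  obtain t where t: "Poly_Mapping.keys t \<subseteq> lists S" "X = exterior_class S t"
    using assms by (rule exterior_algebra_cases)
  define D where "D = (\<lambda>w. g (length w)) ` Poly_Mapping.keys t"
  show thesis
  proof (rule that[of D])
    show "finite D" by (simp add: D_def)
    show "exterior_proj S (\<lambda>k. g k = d) X = \<zero>\<^bsub>exterior_algebra S\<^esub>" if "d \<notin> D" for d
    proof -
      have "frag_extend (length_part (\<lambda>k. g k = d)) t = 0"
        using that by (intro length_part_0) (auto simp: D_def)
      then show ?thesis using t by (simp add: exterior_proj_class exterior_algebra_zero)
    qed
    fix E assume E: "finite E" "D \<subseteq> E"
    have "Poly_Mapping.keys t \<subseteq> {w. g (length w) \<in> E}" using E(2) by (auto simp: D_def)
    then have "t = (\<Sum>d\<in>E. frag_extend (length_part (\<lambda>k. g k = d)) t)"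
    proof (induction t rule: frag_induction)
      case (one w)
      then show ?case using E(1) by (simp add: length_part_def sum.delta)
    qed (simp_all add: frag_extend_diff sum_subtractf)
    then have "X = exterior_class S (\<Sum>d\<in>E. frag_extend (length_part (\<lambda>k. g k = d)) t)"
      using t by simp
    also have "\<dots> = (\<Oplus>\<^bsub>exterior_algebra S\<^esub>d\<in>E. exterior_class S (frag_extend (length_part (\<lambda>k. g k = d)) t))"
      by (rule exterior_class_sum)
         (use E t in \<open>simp_all add: exterior_induced.extend_closed[OF exterior_induced_length_part]\<close>)
    also have "\<dots> = (\<Oplus>\<^bsub>exterior_algebra S\<^esub>d\<in>E. exterior_proj S (\<lambda>k. g k = d) X)"
      using t by (simp add: exterior_proj_class)
    finally show "X = (\<Oplus>\<^bsub>exterior_algebra S\<^esub>d\<in>E. exterior_proj S (\<lambda>k. g k = d) X)" .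
  qed
qed


section \<open>Connected components\<close>

lemma sym_edge_rel: "sym {(x, y). {x, y} \<in> E}"
  by (auto simp: sym_def insert_commute)

lemma connected_comp_self [simp]: "v \<in> connected_comp E v"
  by (simp add: connected_comp_def)

lemma connected_comp_sym: "w \<in> connected_comp E v \<Longrightarrow> v \<in> connected_comp E w"
  using sym_rtrancl[OF sym_edge_rel[of E]] by (auto simp: connected_comp_def sym_def)

lemma connected_comp_trans:
  "\<lbrakk>v \<in> connected_comp E u; w \<in> connected_comp E v\<rbrakk> \<Longrightarrow> w \<in> connected_comp E u"
  by (auto simp: connected_comp_def intro: rtrancl_trans)

lemma connected_comp_edge: "{v, w} \<in> E \<Longrightarrow> w \<in> connected_comp E v"
  by (auto simp: connected_comp_def)

lemma connected_comp_eq: "w \<in> connected_comp E v \<Longrightarrow> connected_comp E w = connected_comp E v"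
  by (auto intro: connected_comp_trans connected_comp_sym)

lemma connected_comp_eq_iff: "connected_comp E w = connected_comp E v \<longleftrightarrow> w \<in> connected_comp E v"
  using connected_comp_eq connected_comp_self by metis

lemma connected_comp_least:
  assumes "v \<in> K" "\<And>x y. \<lbrakk>x \<in> K; {x, y} \<in> E\<rbrakk> \<Longrightarrow> y \<in> K"
  shows "connected_comp E v \<subseteq> K"
proof
  fix w assume "w \<in> connected_comp E v"
  then have "(v, w) \<in> {(x, y). {x, y} \<in> E}\<^sup>*" by (simp add: connected_comp_def)
  then show "w \<in> K" by (induction rule: rtrancl_induct) (use assms in auto)
qed

lemma connected_comp_closed:
  "\<lbrakk>x \<in> connected_comp E v; {x, y} \<in> E\<rbrakk> \<Longrightarrow> y \<in> connected_comp E v"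
  by (rule connected_comp_trans[OF _ connected_comp_edge])

lemma connected_comp_mono: "E \<subseteq> E' \<Longrightarrow> connected_comp E v \<subseteq> connected_comp E' v"
  by (rule connected_comp_least) (auto intro: connected_comp_closed)

lemma connected_comps_eqI: "s \<in> connected_comps V E \<Longrightarrow> v \<in> s \<Longrightarrow> s = connected_comp E v"
  unfolding connected_comps_def by (metis connected_comp_eq imageE)

text \<open>Over an arbitrary vertex set, since besides matchings of the points also matchings of
  the doubled points of a diagram occur.\<close>

definition perfect_matching :: "'v set \<Rightarrow> 'v set set \<Rightarrow> bool"
  where "perfect_matching V M \<longleftrightarrow> partition_on V M \<and> (\<forall>A\<in>M. card A = 2)"

lemma perfect_matchingD:
  assumes "perfect_matching V M"
  shows "\<Union>M = V" "disjoint M" "\<And>A. A \<in> M \<Longrightarrow> card A = 2" "\<And>A. A \<in> M \<Longrightarrow> A \<subseteq> V"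
  using assms by (auto simp: perfect_matching_def partition_on_def)

lemma perfect_matching_unique:
  "\<lbrakk>perfect_matching V M; A \<in> M; B \<in> M; x \<in> A; x \<in> B\<rbrakk> \<Longrightarrow> A = B"
  using perfect_matchingD(2) by (metis disjoint_iff disjointD)

lemma perfect_matching_partner:
  assumes "perfect_matching V M" "x \<in> V"
  obtains y where "{x, y} \<in> M" "y \<noteq> x"
proof -
  obtain A where A: "A \<in> M" "x \<in> A" using perfect_matchingD(1)[OF assms(1)] assms(2) by auto
  then obtain y z where "A = {y, z}" "y \<noteq> z"
    using perfect_matchingD(3)[OF assms(1)] by (metis card_2_iff)
  then show thesis using A that by (metis insert_commute insertE singletonD)
qed

lemma perfect_matching_card:
  assumes "perfect_matching V M" "finite V"
  shows "card V = 2 * card M"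
proof -
  have "card (\<Union>M) = sum card M"
  proof (rule card_Union_disjoint)
    show "pairwise disjnt M"
      using perfect_matchingD(2)[OF assms(1)] by (simp add: disjoint_def pairwise_def disjnt_def)
    show "finite A" if "A \<in> M" for A
      using perfect_matchingD(4)[OF assms(1) that] assms(2) finite_subset by blast
  qed
  then show ?thesis using perfect_matchingD[OF assms(1)] by simp
qed

text \<open>The edges of \<open>M\<close> inside \<open>K\<close> form a perfect matching of
  \<open>K\<close>.\<close>

lemma even_card_matched:
  assumes "perfect_matching V M" "finite V" "K \<subseteq> V"
    and closed: "\<And>x y. \<lbrakk>x \<in> K; {x, y} \<in> M\<rbrakk> \<Longrightarrow> y \<in> K"
  shows "even (card K)"
proof -
  let ?N = "{A \<in> M. A \<subseteq> K}"
  have "\<Union>?N = K"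
  proof
    show "K \<subseteq> \<Union>?N"
    proof
      fix x assume x: "x \<in> K"
      then obtain y where "{x, y} \<in> M"
        using perfect_matching_partner[OF assms(1)] assms(3) by blast
      then show "x \<in> \<Union>?N" using closed[OF x] x by auto
    qed
  qed auto
  then have "perfect_matching K ?N"
    using assms(1) unfolding perfect_matching_def partition_on_def
    by (auto simp: disjoint_def)
  then show ?thesis
    using perfect_matching_card finite_subset[OF assms(3,2)] by fastforce
qed


section \<open>One surgery as an exchange of two edges in a union of two perfect matchings\<close>

section \<open>Surgeries on pairs of perfect matchings\<close>

text \<open>\<open>M\<close> stays fixed, and in \<open>N\<close> the edges \<open>{u, u'}\<close>
  and \<open>{l, l'}\<close> give way to \<open>{u, l}\<close> and \<open>{u', l'}\<close>. In a
  diagram \<open>u, u'\<close> are the ends of the upper copy of the arc and \<open>l, l'\<close>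
  those of the lower copy.\<close>

locale matching_surgery =
  fixes V :: "'v set" and M N :: "'v set set" and u u' l l' :: 'v
  assumes finite_V: "finite V"
    and M: "perfect_matching V M"
    and N: "perfect_matching V N"
    and arcs: "{u, u'} \<in> N" "{l, l'} \<in> N"
    and distinct: "distinct [u, u', l, l']"
begin

definition "common = M \<union> (N - {{u, u'}, {l, l'}})"
definition "old = M \<union> N"
definition "new = common \<union> {{u, l}, {u', l'}}"

lemma old_eq: "old = common \<union> {{u, u'}, {l, l'}}"
  using arcs by (auto simp: old_def common_def)

lemma ends_in: "u \<in> V" "u' \<in> V" "l \<in> V" "l' \<in> V"
  using arcs perfect_matchingD(4)[OF N] by auto

lemma common_comp_old: "connected_comp common v \<subseteq> connected_comp old v"
  by (rule connected_comp_mono) (auto simp: old_eq)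

lemma common_comp_new: "connected_comp common v \<subseteq> connected_comp new v"
  by (rule connected_comp_mono) (auto simp: new_def)

lemma old_edges: "u' \<in> connected_comp old u" "l' \<in> connected_comp old l"
  by (auto simp: old_eq intro: connected_comp_edge)

lemma new_edges: "l \<in> connected_comp new u" "l' \<in> connected_comp new u'"
  by (auto simp: new_def intro: connected_comp_edge)

lemma common_comp_V: "v \<in> V \<Longrightarrow> connected_comp common v \<subseteq> V"
proof (rule connected_comp_least)
  show "y \<in> V" if "{x, y} \<in> common" for x y
    using that perfect_matchingD(4)[OF M] perfect_matchingD(4)[OF N] by (auto simp: common_def)
qed

text \<open>All ends of exchanged edges lie on the old circles of \<open>u\<close> and
  \<open>l\<close>, so a component away from these sees the same edges before and after.\<close>

lemma unaffected:
  assumes "v \<notin> connected_comp old u" "v \<notin> connected_comp old l"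
  shows "connected_comp new v = connected_comp old v"
proof
  have out: "u \<notin> connected_comp old v" "u' \<notin> connected_comp old v"
      "l \<notin> connected_comp old v" "l' \<notin> connected_comp old v"
    using assms old_edges by (meson connected_comp_sym connected_comp_trans)+
  show "connected_comp new v \<subseteq> connected_comp old v"
  proof (rule connected_comp_least)
    show "y \<in> connected_comp old v" if "x \<in> connected_comp old v" "{x, y} \<in> new" for x y
    proof -
      have "{x, y} \<in> old"
        using that out by (auto simp: new_def old_eq doubleton_eq_iff)
      then show ?thesis using that(1) connected_comp_closed by metis
    qed
  qed simp
  \<comment> \<open>Carrying membership in the old component along keeps the walk away from the
    exchanged edges.\<close>
  have "connected_comp old v \<subseteq> connected_comp old v \<inter> connected_comp new v"
  proof (rule connected_comp_least)
    show "y \<in> connected_comp old v \<inter> connected_comp new v"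
      if "x \<in> connected_comp old v \<inter> connected_comp new v" "{x, y} \<in> old" for x y
    proof -
      have "{x, y} \<in> new"
        using that out by (auto simp: new_def old_eq doubleton_eq_iff)
      then show ?thesis
        using that connected_comp_closed[of x old v y] connected_comp_closed[of x new v y] by simp
    qed
  qed simp
  then show "connected_comp old v \<subseteq> connected_comp new v" by auto
qed

text \<open>The union of the two new components contains all four ends, so it is closed under the
  deleted edges as well as under the common ones.\<close>

lemma old_in_new:
  assumes "v \<in> connected_comp old u \<or> v \<in> connected_comp old l"
  shows "v \<in> connected_comp new u \<union> connected_comp new u'"
proof -
  let ?K = "connected_comp new u \<union> connected_comp new u'"
  have cl: "y \<in> ?K" if "x \<in> ?K" "{x, y} \<in> old" for x y
  proof (cases "{x, y} \<in> common")
    case True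
    then show ?thesis using that(1) connected_comp_closed[of x new _ y] by (auto simp: new_def)
  next
    case False
    then show ?thesis using that(2) new_edges by (auto simp: old_eq doubleton_eq_iff)
  qed
  have "connected_comp old u \<subseteq> ?K" "connected_comp old l \<subseteq> ?K"
    using new_edges cl by (intro connected_comp_least; simp)+
  then show ?thesis using assms by blast
qed

text \<open>
  Without the arc from \<open>u\<close> to \<open>u'\<close> these points stay connected: otherwise the component of \<open>u\<close>
  would be closed under \<open>M\<close> and, up to the point \<open>u\<close>, under \<open>N\<close>, so its cardinality would be both
  even and odd.
\<close>

lemma common_path:
  assumes "l \<notin> connected_comp old u"
  shows "u' \<in> connected_comp common u"
proof (rule ccontr)
  let ?K = "connected_comp common u"
  assume u': "u' \<notin> ?K"
  \<comment> \<open>With this the only deleted edge that meets \<open>?K\<close> is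
    \<open>{u, u'}\<close>, and it does so at \<open>u\<close> alone.\<close>
  have l: "l \<notin> ?K" "l' \<notin> ?K"
    using assms common_comp_old[of u] connected_comp_trans[OF _ connected_comp_sym[OF old_edges(2)]]
    by (meson subsetD)+
  have K: "?K \<subseteq> V" using common_comp_V ends_in by blast
  have "even (card ?K)"
    by (rule even_card_matched[OF M finite_V K])
       (auto simp: common_def intro: connected_comp_closed)
  moreover have "even (card (?K - {u}))"
  proof (rule even_card_matched[OF N finite_V])
    fix x y assume x: "x \<in> ?K - {u}" and xy: "{x, y} \<in> N"
    have "{x, y} \<noteq> {u, u'}" "{x, y} \<noteq> {l, l'}" using x u' l by (auto simp: doubleton_eq_iff)
    then have "{x, y} \<in> common" using xy by (auto simp: common_def)
    moreover have "y \<noteq> u"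
    proof
      assume "y = u"
      then have "{x, y} = {u, u'}"
        using perfect_matching_unique[OF N xy arcs(1), of u] by auto
      then show False using \<open>{x, y} \<noteq> {u, u'}\<close> by simp
    qed
    ultimately show "y \<in> ?K - {u}" using x connected_comp_closed by fastforce
  qed (use K in auto)
  moreover have "finite ?K" using K finite_V finite_subset by blast
  then have "card ?K = Suc (card (?K - {u}))"
    by (metis card.remove connected_comp_self)
  ultimately show False by (metis even_Suc)
qed

text \<open>By \<open>common_path\<close> the points \<open>u\<close> and \<open>u'\<close> stay
  connected, so the two components in \<open>old_in_new\<close> coincide.\<close>

lemma merge_comp:
  assumes "l \<notin> connected_comp old u" "v \<in> connected_comp old u \<or> v \<in> connected_comp old l"
  shows "connected_comp new v = connected_comp new u"
proof -
  have "u' \<in> connected_comp new u" using common_path[OF assms(1)] common_comp_new by blast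
  then have "connected_comp new u' = connected_comp new u" by (rule connected_comp_eq)
  then have "v \<in> connected_comp new u" using old_in_new[OF assms(2)] by auto
  then show ?thesis by (rule connected_comp_eq)
qed

lemma merge_comps:
  assumes "l \<notin> connected_comp old u"
  shows "connected_comps V new =
      insert (connected_comp new u) (connected_comps V old - {connected_comp old u, connected_comp old l})"
    (is "?L = ?R")
proof
  show "?L \<subseteq> ?R"
  proof
    fix s assume "s \<in> ?L"
    then obtain v where v: "v \<in> V" "s = connected_comp new v" by (auto simp: connected_comps_def)
    show "s \<in> ?R"
    proof (cases "v \<in> connected_comp old u \<or> v \<in> connected_comp old l")
      case True
      then show ?thesis using merge_comp[OF assms True] v(2) by simp
    next
      case False
      then have "s = connected_comp old v" using unaffected v by auto
      then show ?thesis using False v by (auto simp: connected_comps_def connected_comp_eq_iff)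
    qed
  qed
  show "?R \<subseteq> ?L"
  proof
    fix s assume "s \<in> ?R"
    then consider "s = connected_comp new u"
      | v where "v \<in> V" "s = connected_comp old v" "s \<noteq> connected_comp old u" "s \<noteq> connected_comp old l"
      by (auto simp: connected_comps_def)
    then show "s \<in> ?L"
    proof cases
      case 1
      then show ?thesis using ends_in by (auto simp: connected_comps_def)
    next
      case (2 v)
      then have "s = connected_comp new v" by (subst unaffected) (auto simp: connected_comp_eq_iff)
      then show ?thesis using 2 by (auto simp: connected_comps_def)
    qed
  qed
qed

lemma finite_comps: "finite (connected_comps V E)"
  using finite_V by (simp add: connected_comps_def)

lemma ends_comps: "connected_comp E u \<in> connected_comps V E" "connected_comp E l \<in> connected_comps V E"
    "connected_comp E u' \<in> connected_comps V E"
  using ends_in by (auto simp: connected_comps_def)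

text \<open>Makes the insertions in \<open>merge_comps\<close> and \<open>split_comps\<close> count:
  a new circle through \<open>x\<close> that is also an old circle would be the old circle through
  \<open>x\<close>, which has been removed.\<close>

lemma new_notin_rest:
  assumes "x \<in> connected_comp old u \<or> x \<in> connected_comp old l"
  shows "connected_comp new x \<notin> connected_comps V old - {connected_comp old u, connected_comp old l}"
proof
  assume "connected_comp new x \<in> connected_comps V old - {connected_comp old u, connected_comp old l}"
  then have "connected_comp new x = connected_comp old x"
      "connected_comp new x \<noteq> connected_comp old u" "connected_comp new x \<noteq> connected_comp old l"
    using connected_comps_eqI[of "connected_comp new x" V old x] by auto
  then show False using assms connected_comp_eq by metis
qed

lemma merge_card:
  assumes "l \<notin> connected_comp old u"
  shows "card (connected_comps V old) = Suc (card (connected_comps V new))"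
proof -
  let ?R = "connected_comps V old - {connected_comp old u, connected_comp old l}"
  have "connected_comp old u \<noteq> connected_comp old l"
    using assms connected_comp_self by metis
  then have "card (connected_comps V old) = Suc (Suc (card ?R))"
    using ends_comps finite_comps[of old]
    by (metis (no_types, lifting) Diff_insert2 card.remove finite_Diff insert_Diff insert_iff)
  moreover have "card (connected_comps V new) = Suc (card ?R)"
    unfolding merge_comps[OF assms]
    using new_notin_rest[of u] finite_comps[of old] by (intro card_insert_disjoint) auto
  ultimately show ?thesis by simp
qed

text \<open>By \<open>old_in_new\<close> the new circles through \<open>u\<close> and
  \<open>u'\<close> cover the old circle. They are not claimed to be different; that is a hypothesis
  of \<open>split_card\<close>.\<close>

lemma split_comps:
  assumes "l \<in> connected_comp old u"
  shows "connected_comps V new =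
      insert (connected_comp new u) (insert (connected_comp new u') (connected_comps V old - {connected_comp old u}))"
    (is "?L = ?R")
proof
  have eq: "connected_comp old l = connected_comp old u" using connected_comp_eq[OF assms] .
  show "?L \<subseteq> ?R"
  proof
    fix s assume "s \<in> ?L"
    then obtain v where v: "v \<in> V" "s = connected_comp new v" by (auto simp: connected_comps_def)
    show "s \<in> ?R"
    proof (cases "v \<in> connected_comp old u")
      case True
      then show ?thesis using old_in_new[of v] v connected_comp_eq[of v new] by auto
    next
      case False
      then have "s = connected_comp old v" using unaffected v eq by auto
      then show ?thesis using False v by (auto simp: connected_comps_def connected_comp_eq_iff)
    qed
  qed
  show "?R \<subseteq> ?L"
  proof
    fix s assume "s \<in> ?R"
    then consider "s = connected_comp new u" | "s = connected_comp new u'"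
      | v where "v \<in> V" "s = connected_comp old v" "s \<noteq> connected_comp old u"
      by (auto simp: connected_comps_def)
    then show "s \<in> ?L"
    proof cases
      case (3 v)
      then have "s = connected_comp new v"
        by (subst unaffected) (auto simp: connected_comp_eq_iff eq)
      then show ?thesis using 3 by (auto simp: connected_comps_def)
    qed (use ends_in in \<open>auto simp: connected_comps_def\<close>)
  qed
qed

lemma split_card:
  assumes "l \<in> connected_comp old u" "connected_comp new u \<noteq> connected_comp new u'"
  shows "card (connected_comps V new) = Suc (card (connected_comps V old))"
proof -
  have eq: "connected_comp old l = connected_comp old u" using connected_comp_eq[OF assms(1)] .
  let ?R = "connected_comps V old - {connected_comp old u}"
  have "card (connected_comps V old) = Suc (card ?R)"
    using ends_comps finite_comps[of old] by (metis card.remove)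
  moreover have "card (connected_comps V new) = Suc (Suc (card ?R))"
    unfolding split_comps[OF assms(1)]
    using new_notin_rest[of u] new_notin_rest[of u'] old_edges(1) eq assms(2) finite_comps[of old]
    by (auto simp: card_insert_if)
  ultimately show ?thesis by simp
qed

end


section \<open>Diagrams as unions of two perfect matchings of the doubled points\<close>

section \<open>Diagrams\<close>

lemma perfect_matchingI:
  assumes "\<Union>M = V" "\<And>A. A \<in> M \<Longrightarrow> card A = 2"
    and "\<And>A B x. \<lbrakk>A \<in> M; B \<in> M; x \<in> A; x \<in> B\<rbrakk> \<Longrightarrow> A = B"
  shows "perfect_matching V M"
  unfolding perfect_matching_def partition_on_def disjoint_def
  using assms by fastforce

text \<open>The edges at \<open>f x\<close> are exactly the images of the edges at \<open>x\<close>,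
  so a walk from \<open>f v\<close> lifts step by step and never leaves the image.\<close>

lemma connected_comp_image:
  assumes edge: "\<And>x z. {f x, z} \<in> E' \<longleftrightarrow> (\<exists>y. z = f y \<and> {x, y} \<in> E)"
  shows "connected_comp E' (f v) = f ` connected_comp E v"
proof
  show "connected_comp E' (f v) \<subseteq> f ` connected_comp E v"
  proof (rule connected_comp_least)
    fix z w assume "z \<in> f ` connected_comp E v" "{z, w} \<in> E'"
    then obtain x y where "x \<in> connected_comp E v" "w = f y" "{x, y} \<in> E" using edge by blast
    then show "w \<in> f ` connected_comp E v" using connected_comp_closed[of x E v y] by blast
  qed simp
  have "connected_comp E v \<subseteq> {w. f w \<in> connected_comp E' (f v)}"
  proof (rule connected_comp_least)
    fix x y assume "x \<in> {w. f w \<in> connected_comp E' (f v)}" "{x, y} \<in> E"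
    then show "y \<in> {w. f w \<in> connected_comp E' (f v)}"
      using edge connected_comp_closed[of "f x" E' "f v" "f y"] by blast
  qed simp
  then show "f ` connected_comp E v \<subseteq> connected_comp E' (f v)" by blast
qed

text \<open>\<open>horizontal c a\<close> is the part of a diagram that no surgery touches;
  \<open>horizontal (b - P) (b - P)\<close> holds both copies of the arcs not yet surgered.\<close>

definition horizontal :: "matching \<Rightarrow> matching \<Rightarrow> vertex set set"
  where "horizontal c a = (`) (Pair Upper) ` c \<union> (`) (Pair Lower) ` a"

definition vertical :: "nat set \<Rightarrow> vertex set set"
  where "vertical I = (\<lambda>i. {(Upper, i), (Lower, i)}) ` I"

text \<open>The bracketing exhibits the two matchings to which \<open>matching_surgery\<close> is
  applied.\<close>

lemma diagram_eq: "diagram c b a P = horizontal c a \<union> (horizontal (b - P) (b - P) \<union> vertical (\<Union>P))"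
  by (auto simp: diagram_def horizontal_def vertical_def)

lemma level_UNIV: "(UNIV :: level set) = {Upper, Lower}"
  using level.exhaust by auto

lemma inj_image_Pair: "inj ((`) (Pair \<epsilon>))"
  by (rule injI) (auto simp: set_eq_iff image_iff)

lemma horizontal_edge:
  "{(Upper, x), (Upper, y)} \<in> horizontal c a \<longleftrightarrow> {x, y} \<in> c"
  "{(Lower, x), (Lower, y)} \<in> horizontal c a \<longleftrightarrow> {x, y} \<in> a"
proof -
  have "Pair \<epsilon> ` {x, y} \<in> (`) (Pair \<epsilon>) ` M \<longleftrightarrow> {x, y} \<in> M" for \<epsilon> :: level and M
    by (rule inj_image_mem_iff[OF inj_image_Pair])
  then show "{(Upper, x), (Upper, y)} \<in> horizontal c a \<longleftrightarrow> {x, y} \<in> c"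
    "{(Lower, x), (Lower, y)} \<in> horizontal c a \<longleftrightarrow> {x, y} \<in> a"
    by (auto simp: horizontal_def)
qed

lemma horizontal_cases:
  assumes "{(\<epsilon>, x), (\<delta>, y)} \<in> horizontal c a"
  shows "\<epsilon> = \<delta> \<and> {x, y} \<in> (if \<epsilon> = Upper then c else a)"
proof -
  obtain \<eta> A where A: "{(\<epsilon>, x), (\<delta>, y)} = Pair \<eta> ` A"
    using assms by (auto simp: horizontal_def)
  have "(\<epsilon>, x) \<in> Pair \<eta> ` A" "(\<delta>, y) \<in> Pair \<eta> ` A" unfolding A[symmetric] by auto
  then have "\<epsilon> = \<delta>" by auto
  then show ?thesis using assms horizontal_edge by (cases \<epsilon>) auto
qed

lemma vertical_edge: "{(\<epsilon>, x), (\<delta>, y)} \<in> vertical I \<longleftrightarrow> \<epsilon> \<noteq> \<delta> \<and> x = y \<and> x \<in> I"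
  by (cases \<epsilon>; cases \<delta>) (auto simp: vertical_def doubleton_eq_iff)

lemma card_Pair_image: "card (Pair \<epsilon> ` A) = card A"
  by (rule card_image) (auto intro: inj_onI)

lemma Union_Pair_image: "\<Union>((`) (Pair \<epsilon>) ` M) = {\<epsilon>} \<times> \<Union>M"
  by auto

lemma perfect_matching_horizontal:
  assumes c: "perfect_matching X c" and a: "perfect_matching X a"
  shows "perfect_matching (UNIV \<times> X) (horizontal c a)"
proof (rule perfect_matchingI)
  show "\<Union>(horizontal c a) = UNIV \<times> X"
    using perfect_matchingD(1)[OF c] perfect_matchingD(1)[OF a]
    by (simp add: horizontal_def Union_Pair_image level_UNIV) blast
  show "card A = 2" if "A \<in> horizontal c a" for A
    using that perfect_matchingD(3)[OF c] perfect_matchingD(3)[OF a]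
    by (auto simp: horizontal_def card_Pair_image)
  show "A = B" if "A \<in> horizontal c a" "B \<in> horizontal c a" "x \<in> A" "x \<in> B" for A B x
    using that perfect_matching_unique[OF c] perfect_matching_unique[OF a]
    by (auto simp: horizontal_def) blast+
qed

text \<open>A doubled point over \<open>\<Union>P\<close> is matched vertically, any other one by
  the copy of its arc of \<open>b\<close> on its own level.\<close>

lemma perfect_matching_surgered:
  assumes b: "perfect_matching X b" and P: "P \<subseteq> b"
  shows "perfect_matching (UNIV \<times> X) (horizontal (b - P) (b - P) \<union> vertical (\<Union>P))"
proof (rule perfect_matchingI)
  show "\<Union>(horizontal (b - P) (b - P) \<union> vertical (\<Union>P)) = UNIV \<times> X"
    using perfect_matchingD(1)[OF b] P
    by (auto simp: horizontal_def vertical_def level_UNIV)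
  show "card A = 2" if "A \<in> horizontal (b - P) (b - P) \<union> vertical (\<Union>P)" for A
    using that perfect_matchingD(3)[OF b]
    by (auto simp: horizontal_def vertical_def card_Pair_image)
  have out: "i \<notin> \<Union>P" if "A \<in> b - P" "i \<in> A" for A i
    using that P perfect_matching_unique[OF b] by blast
  have rep: "(\<exists>A'\<in>b - P. i \<in> A' \<and> A = Pair \<epsilon> ` A') \<or> i \<in> \<Union>P \<and> A = {(Upper, i), (Lower, i)}"
    if "A \<in> horizontal (b - P) (b - P) \<union> vertical (\<Union>P)" "(\<epsilon>, i) \<in> A" for A \<epsilon> i
    using that by (auto simp: horizontal_def vertical_def)
  show "A = B" if AB: "A \<in> horizontal (b - P) (b - P) \<union> vertical (\<Union>P)"
      "B \<in> horizontal (b - P) (b - P) \<union> vertical (\<Union>P)" "x \<in> A" "x \<in> B" for A B x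
  proof -
    obtain \<epsilon> i where x: "x = (\<epsilon>, i)" by fastforce
    show ?thesis
    proof (cases "i \<in> \<Union>P")
      case True
      then show ?thesis
        using rep[of A \<epsilon> i] rep[of B \<epsilon> i] AB out unfolding x by blast
    next
      case False
      then obtain A' B' where "A' \<in> b" "i \<in> A'" "A = Pair \<epsilon> ` A'" "B' \<in> b" "i \<in> B'" "B = Pair \<epsilon> ` B'"
        using rep[of A \<epsilon> i] rep[of B \<epsilon> i] AB unfolding x by blast
      then show ?thesis using perfect_matching_unique[OF b] by blast
    qed
  qed
qed

text \<open>Brings a surgery into the form of \<open>matching_surgery\<close>: two edges out, two
  edges in.\<close>

lemma surgered_insert:
  assumes b: "perfect_matching X b" and P: "P \<subseteq> b" and ij: "{i, j} \<in> b" "{i, j} \<notin> P"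
  shows "horizontal (b - insert {i, j} P) (b - insert {i, j} P) \<union> vertical (\<Union>(insert {i, j} P)) =
    (horizontal (b - P) (b - P) \<union> vertical (\<Union>P)
      - {{(Upper, i), (Upper, j)}, {(Lower, i), (Lower, j)}})
    \<union> {{(Upper, i), (Lower, i)}, {(Upper, j), (Lower, j)}}" (is "?L = ?R")
proof -
  have "b - insert {i, j} P = (b - P) - {{i, j}}" by blast
  then have level: "(`) (Pair \<epsilon>) ` (b - insert {i, j} P) = (`) (Pair \<epsilon>) ` (b - P) - {{(\<epsilon>, i), (\<epsilon>, j)}}"
    for \<epsilon> :: level
    by (simp add: image_set_diff[OF inj_image_Pair])
  have "{(\<epsilon>, i), (\<epsilon>, j)} \<notin> (`) (Pair \<delta>) ` (b - P)" if "\<epsilon> \<noteq> \<delta>" for \<epsilon> \<delta> :: level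
  proof
    assume "{(\<epsilon>, i), (\<epsilon>, j)} \<in> (`) (Pair \<delta>) ` (b - P)"
    then obtain A where "{(\<epsilon>, i), (\<epsilon>, j)} = Pair \<delta> ` A" by auto
    then have "(\<epsilon>, i) \<in> Pair \<delta> ` A" by auto
    then show False using that by auto
  qed
  then have h: "horizontal (b - insert {i, j} P) (b - insert {i, j} P) =
      horizontal (b - P) (b - P) - {{(Upper, i), (Upper, j)}, {(Lower, i), (Lower, j)}}"
    unfolding horizontal_def level by blast
  have v: "vertical (\<Union>(insert {i, j} P)) =
      vertical (\<Union>P) \<union> {{(Upper, i), (Lower, i)}, {(Upper, j), (Lower, j)}}"
    by (auto simp: vertical_def)
  \<comment> \<open>Vertical edges join different levels, so the deletion of the two horizontal
    copies can be moved past them.\<close>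
  have d: "vertical (\<Union>P) \<inter> {{(Upper, i), (Upper, j)}, {(Lower, i), (Lower, j)}} = {}"
    by (auto simp: vertical_edge)
  have "(H - S) \<union> (W \<union> W') = (H \<union> W - S) \<union> W'" if "W \<inter> S = {}" for H S W W' :: "vertex set set"
    using that by blast
  from this[OF d] show ?thesis unfolding h v .
qed

lemma crossingless_matchingD: "b \<in> crossingless_matchings n \<Longrightarrow> perfect_matching {1..2 * n} b"
  by (simp add: crossingless_matchings_def perfect_matching_def)

lemma diagram_surgery:
  assumes "perfect_matching {1..2 * n} c" "perfect_matching {1..2 * n} b" "perfect_matching {1..2 * n} a"
    and P: "P \<subseteq> b" and ij: "{i, j} \<in> b" "{i, j} \<notin> P"
  shows "matching_surgery (UNIV \<times> {1..2 * n}) (horizontal c a)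
      (horizontal (b - P) (b - P) \<union> vertical (\<Union>P)) (Upper, i) (Upper, j) (Lower, i) (Lower, j)"
    and "matching_surgery.old (horizontal c a) (horizontal (b - P) (b - P) \<union> vertical (\<Union>P))
      = diagram c b a P"
    and "matching_surgery.new (horizontal c a) (horizontal (b - P) (b - P) \<union> vertical (\<Union>P))
      (Upper, i) (Upper, j) (Lower, i) (Lower, j) = diagram c b a (insert {i, j} P)"
proof -
  have "i \<noteq> j" using perfect_matchingD(3)[OF assms(2) ij(1)] by auto
  then show ms: "matching_surgery (UNIV \<times> {1..2 * n}) (horizontal c a)
      (horizontal (b - P) (b - P) \<union> vertical (\<Union>P)) (Upper, i) (Upper, j) (Lower, i) (Lower, j)"
    using assms perfect_matching_horizontal perfect_matching_surgered
    by unfold_locales (auto simp: horizontal_edge level_UNIV)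
  show "matching_surgery.old (horizontal c a) (horizontal (b - P) (b - P) \<union> vertical (\<Union>P))
      = diagram c b a P"
    by (simp add: matching_surgery.old_def[OF ms] diagram_eq)
  show "matching_surgery.new (horizontal c a) (horizontal (b - P) (b - P) \<union> vertical (\<Union>P))
      (Upper, i) (Upper, j) (Lower, i) (Lower, j) = diagram c b a (insert {i, j} P)"
    unfolding matching_surgery.new_def[OF ms] matching_surgery.common_def[OF ms]
      diagram_eq surgered_insert[OF assms(2) P ij]
    by (simp only: Un_assoc)
qed


section \<open>Additivity and degree of surgeries, and chains of merges\<close>

section \<open>Surgery maps\<close>

locale three_matchings =
  fixes n :: nat and c b a :: matching
  assumes c: "perfect_matching {1..2 * n} c"
    and b: "perfect_matching {1..2 * n} b"
    and a: "perfect_matching {1..2 * n} a"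
begin

abbreviation "circ P \<equiv> diagram_circles n c b a P"
abbreviation "component P \<equiv> connected_comp (diagram c b a P)"

context
  fixes P i j
  assumes P: "P \<subseteq> b" and ij: "{i, j} \<in> b" "{i, j} \<notin> P"
begin

interpretation S: matching_surgery "UNIV \<times> {1..2 * n}" "horizontal c a"
    "horizontal (b - P) (b - P) \<union> vertical (\<Union>P)" "(Upper, i)" "(Upper, j)" "(Lower, i)" "(Lower, j)"
  by (rule diagram_surgery(1)[OF c b a P ij])

lemmas old_new = diagram_surgery(2,3)[OF c b a P ij]

text \<open>The merged circles are covered by \<open>merge_comp\<close>, the others by
  \<open>unaffected\<close>. In this pointwise form merges compose without a description of the
  intermediate circles.\<close>

lemma merge_map:
  assumes "component P (Upper, i) \<noteq> component P (Lower, i)" "v \<in> UNIV \<times> {1..2 * n}"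
  shows "(if component P v = component P (Upper, i) \<or> component P v = component P (Lower, i)
      then component (insert {i, j} P) (Upper, i) else component P v) = component (insert {i, j} P) v"
  using S.merge_comp[of v] S.unaffected[of v] assms
  unfolding old_new by (auto simp: connected_comp_eq_iff) (metis connected_comp_eq connected_comp_self)+

lemma merge_map_closed:
  assumes "component P (Upper, i) \<noteq> component P (Lower, i)"
  shows "(\<lambda>s. if s = component P (Upper, i) \<or> s = component P (Lower, i)
      then component (insert {i, j} P) (Upper, i) else s) ` circ P \<subseteq> circ (insert {i, j} P)"
proof
  fix s assume "s \<in> (\<lambda>s. if s = component P (Upper, i) \<or> s = component P (Lower, i)
      then component (insert {i, j} P) (Upper, i) else s) ` circ P"
  then obtain t where t: "t \<in> circ P" "s = (if t = component P (Upper, i) \<or> t = component P (Lower, i)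
      then component (insert {i, j} P) (Upper, i) else t)"
    by (elim imageE)
  obtain v where v: "v \<in> UNIV \<times> {1..2 * n}" "t = component P v"
    using t(1) unfolding diagram_circles_def connected_comps_def by (elim imageE)
  have "s = component (insert {i, j} P) v"
    unfolding t(2) v(2) by (rule merge_map[OF assms v(1)])
  with v(1) show "s \<in> circ (insert {i, j} P)" by (simp add: diagram_circles_def connected_comps_def)
qed

lemma split_map_closed:
  assumes "component P (Upper, i) = component P (Lower, i)"
  shows "(\<lambda>s. if s = component P (Upper, i) then component (insert {i, j} P) (Upper, i) else s) ` circ P
    \<subseteq> circ (insert {i, j} P)"
proof -
  have "(Lower, i) \<in> component P (Upper, i)" using assms connected_comp_self by metis
  from S.split_comps[unfolded old_new, OF this] show ?thesis
    by (auto simp: diagram_circles_def)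
qed

lemma surgery_map_merge:
  assumes "component P (Upper, i) \<noteq> component P (Lower, i)"
  shows "surgery_map n c b a P (i, j) =
    exterior_map (circ (insert {i, j} P)) (\<lambda>s. if s = component P (Upper, i) \<or> s = component P (Lower, i)
      then component (insert {i, j} P) (Upper, i) else s)"
  using assms by (simp add: surgery_map_def fun_eq_iff Let_def)

lemma surgery_map_split:
  assumes "component P (Upper, i) = component P (Lower, i)"
  shows "surgery_map n c b a P (i, j) = (\<lambda>x.
    exterior_vec (circ (insert {i, j} P))
        (frag_of (component (insert {i, j} P) (Upper, i)) - frag_of (component (insert {i, j} P) (Upper, j)))
      \<otimes>\<^bsub>exterior_algebra (circ (insert {i, j} P))\<^esub>
      exterior_map (circ (insert {i, j} P))
        (\<lambda>s. if s = component P (Upper, i) then component (insert {i, j} P) (Upper, i) else s) x)"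
  using assms by (simp add: surgery_map_def fun_eq_iff Let_def)

lemma split_vec_keys:
  "Poly_Mapping.keys (frag_of (component (insert {i, j} P) (Upper, i)) - frag_of (component (insert {i, j} P) (Upper, j)))
    \<subseteq> circ (insert {i, j} P)"
  by (rule keys_diff_subset)
     (use S.ends_comps in \<open>auto simp: diagram_circles_def\<close>)

lemma surgery_map_hom:
  "surgery_map n c b a P (i, j)
    \<in> hom (add_monoid (exterior_algebra (circ P))) (add_monoid (exterior_algebra (circ (insert {i, j} P))))"
proof (cases "component P (Upper, i) = component P (Lower, i)")
  case False
  then show ?thesis
    unfolding surgery_map_merge[OF False]
    by (intro exterior_map_hom merge_map_closed)
next
  case True
  interpret R: ring "exterior_algebra (circ (insert {i, j} P))" by (rule ring_exterior_algebra)
  let ?v = "exterior_vec (circ (insert {i, j} P))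
      (frag_of (component (insert {i, j} P) (Upper, i)) - frag_of (component (insert {i, j} P) (Upper, j)))"
  have v: "?v \<in> carrier (exterior_algebra (circ (insert {i, j} P)))"
    by (rule exterior_part_carrier[OF exterior_vec_part[OF split_vec_keys, of "\<lambda>_. True"]]) simp
  have m: "(\<otimes>\<^bsub>exterior_algebra (circ (insert {i, j} P))\<^esub>) ?v
      \<in> hom (add_monoid (exterior_algebra (circ (insert {i, j} P))))
          (add_monoid (exterior_algebra (circ (insert {i, j} P))))"
    by (rule homI) (use v in \<open>auto simp: R.r_distr\<close>)
  show ?thesis
    using hom_compose[OF exterior_map_hom[OF split_map_closed[OF True]] m]
    by (simp add: surgery_map_split[OF True] comp_def)
qed

text \<open>A split which fails to separate the two points contributes the zero vector.\<close>

lemma surgery_map_part: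
  assumes X: "X \<in> exterior_part (circ P) (\<lambda>k. 2 * int k - int (card (circ P)) = d)"
  shows "surgery_map n c b a P (i, j) X \<in> exterior_part (circ (insert {i, j} P))
    (\<lambda>k. 2 * int k - int (card (circ (insert {i, j} P))) = d + 1)"
proof (cases "component P (Upper, i) = component P (Lower, i)")
  case False
  then have "(Lower, i) \<notin> component P (Upper, i)" using connected_comp_eq by metis
  from S.merge_card[unfolded old_new, OF this]
  have "card (circ P) = Suc (card (circ (insert {i, j} P)))" by (simp add: diagram_circles_def)
  \<comment> \<open>The words keep their length while one circle disappears.\<close>
  then show ?thesis
    unfolding surgery_map_merge[OF False]
    by (intro exterior_part_mono[OF exterior_map_part[OF X merge_map_closed[OF False]]]) auto
next
  case True
  have l: "(Lower, i) \<in> component P (Upper, i)" using True connected_comp_self by metis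
  let ?E = "exterior_algebra (circ (insert {i, j} P))"
  interpret R: ring ?E by (rule ring_exterior_algebra)
  note im = exterior_map_part[OF X split_map_closed[OF True]]
  show ?thesis
  proof (cases "component (insert {i, j} P) (Upper, i) = component (insert {i, j} P) (Upper, j)")
    case eq: True
    show ?thesis
      unfolding surgery_map_split[OF True]
      using exterior_part_carrier[OF im] by (simp add: eq exterior_vec_0 exterior_part_zero)
  next
    case False
    from S.split_card[unfolded old_new, OF l False]
    have "card (circ (insert {i, j} P)) = Suc (card (circ P))" by (simp add: diagram_circles_def)
    \<comment> \<open>The extra factor raises \<open>2 * int k\<close> by 2, the extra circle takes
      1 away.\<close>
    then show ?thesis
      unfolding surgery_map_split[OF True]
      by (intro exterior_part_mult[OF exterior_vec_part[OF split_vec_keys, of "\<lambda>k. k = 1"] im]) auto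
  qed
qed

text \<open>With each generator marked by a vertex \<open>\<kappa> s\<close>, a merge changes
  nothing but the set of surgered arcs. This is the induction step of
  \<open>surgeries_merges\<close>.\<close>

lemma surgery_map_comp:
  assumes "component P (Upper, i) \<noteq> component P (Lower, i)" "\<kappa> ` S \<subseteq> UNIV \<times> {1..2 * n}"
    and "X \<in> carrier (exterior_algebra S)"
  shows "surgery_map n c b a P (i, j) (exterior_map (circ P) (\<lambda>s. component P (\<kappa> s)) X) =
    exterior_map (circ (insert {i, j} P)) (\<lambda>s. component (insert {i, j} P) (\<kappa> s)) X"
  unfolding surgery_map_merge[OF assms(1)]
proof (rule exterior_map_comp)
  show "(\<lambda>s. component P (\<kappa> s)) ` S \<subseteq> circ P"
    using assms(2) by (auto simp: diagram_circles_def connected_comps_def)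
  show "(if component P (\<kappa> s) = component P (Upper, i) \<or> component P (\<kappa> s) = component P (Lower, i)
      then component (insert {i, j} P) (Upper, i) else component P (\<kappa> s)) =
    component (insert {i, j} P) (\<kappa> s)" if "s \<in> S" for s
    using assms(2) that by (intro merge_map[OF assms(1)]) blast
qed (rule merge_map_closed[OF assms(1)], rule assms(3))

end

text \<open>The set of arcs with which a run of \<open>surgeries\<close> over \<open>ps\<close> that
  starts at \<open>P\<close> ends.\<close>

abbreviation "surgered P ps \<equiv> P \<union> {A \<in> b. A \<inter> set ps \<noteq> {}}"

text \<open>Case rule for inductions over the list of points. It hides the \<open>THE\<close> of the
  recursion and leaves only some oriented arc of \<open>b\<close> outside \<open>P\<close>, along
  with the bookkeeping of the final set of arcs.\<close>

lemma surgeries_step: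
  assumes ps: "set (p # ps) \<subseteq> {1..2 * n}" and ori: "ori \<in> arc_orientations b" and P: "P \<subseteq> b"
  obtains (skip) "surgeries n c b a ori (p # ps) P = surgeries n c b a ori ps P"
      "surgered P (p # ps) = surgered P ps"
    | (surger) i j where "{i, j} \<in> b" "{i, j} \<notin> P"
      "surgeries n c b a ori (p # ps) P =
        surgeries n c b a ori ps (insert {i, j} P) \<circ> surgery_map n c b a P (i, j)"
      "surgered P (p # ps) = surgered (insert {i, j} P) ps"
proof -
  have "p \<in> \<Union>b" using ps perfect_matchingD(1)[OF b] by auto
  then obtain A where A: "A \<in> b" "p \<in> A" by auto
  have uniq: "p \<in> B \<longleftrightarrow> B = A" if "B \<in> b" for B
    using perfect_matching_unique[OF b that A(1), of p] A(2) by blast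
  have the: "(THE A. A \<in> b \<and> p \<in> A) = A"
    by (rule the_equality) (use A uniq in blast)+
  have arcs: "{B \<in> b. B \<inter> set (p # ps) \<noteq> {}} = insert A {B \<in> b. B \<inter> set ps \<noteq> {}}"
    using A(1) uniq by auto
  show thesis
  proof (cases "A \<in> P")
    case True
    show thesis
      by (rule skip) (use True arcs in \<open>auto simp: fun_eq_iff the\<close>)
  next
    case False
    obtain i j where ij: "ori A = (i, j)" by fastforce
    then have "{i, j} = A" using ori A(1) by (auto simp: arc_orientations_def PiE_iff)
    then show thesis
      using False arcs A ij by (intro surger[of i j]) (auto simp: fun_eq_iff the)
  qed
qed

lemma surgeries_hom:
  assumes "set ps \<subseteq> {1..2 * n}" "ori \<in> arc_orientations b" "P \<subseteq> b"
  shows "surgeries n c b a ori ps P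
    \<in> hom (add_monoid (exterior_algebra (circ P))) (add_monoid (exterior_algebra (circ (surgered P ps))))"
  using assms
proof (induction ps arbitrary: P)
  case Nil
  then show ?case by (auto simp: hom_def)
next
  case (Cons p ps)
  from Cons.prems show ?case
  proof (cases rule: surgeries_step)
    case skip
    show ?thesis unfolding skip using Cons by simp
  next
    case (surger i j)
    show ?thesis unfolding surger(3,4)
      by (rule hom_compose[OF surgery_map_hom Cons.IH]) (use Cons.prems surger in auto)
  qed
qed

text \<open>Each surgery contributes 1 by \<open>surgery_map_part\<close>, and the difference of
  cardinalities counts the surgeries.\<close>

lemma surgeries_part:
  assumes "set ps \<subseteq> {1..2 * n}" "ori \<in> arc_orientations b" "P \<subseteq> b"
    and "X \<in> exterior_part (circ P) (\<lambda>k. 2 * int k - int (card (circ P)) = d)"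
  shows "surgeries n c b a ori ps P X \<in> exterior_part (circ (surgered P ps))
    (\<lambda>k. 2 * int k - int (card (circ (surgered P ps))) = d + int (card (surgered P ps)) - int (card P))"
  using assms
proof (induction ps arbitrary: P X d)
  case Nil
  then show ?case by simp
next
  case (Cons p ps)
  from Cons.prems(1-3) show ?case
  proof (cases rule: surgeries_step)
    case skip
    show ?thesis unfolding skip using Cons by simp
  next
    case (surger i j)
    have "finite b"
      using finite_UnionD[of b] perfect_matchingD(1)[OF b] by simp
    then have fin: "finite P" using Cons.prems(3) finite_subset by blast
    have "surgeries n c b a ori ps (insert {i, j} P) (surgery_map n c b a P (i, j) X)
      \<in> exterior_part (circ (surgered (insert {i, j} P) ps))
        (\<lambda>k. 2 * int k - int (card (circ (surgered (insert {i, j} P) ps))) =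
          (d + 1) + int (card (surgered (insert {i, j} P) ps)) - int (card (insert {i, j} P)))"
      by (rule Cons.IH) (use Cons.prems surger surgery_map_part in auto)
    then show ?thesis unfolding surger(3,4) using surger(2) fin by (simp add: algebra_simps)
  qed
qed

text \<open>The hypothesis \<open>merge\<close> covers every intermediate set of arcs, as the order
  of the surgeries is left open.\<close>

lemma surgeries_merges:
  assumes "set ps \<subseteq> {1..2 * n}" "ori \<in> arc_orientations b" "P \<subseteq> b"
    and \<kappa>: "\<kappa> ` S \<subseteq> UNIV \<times> {1..2 * n}" and X: "X \<in> carrier (exterior_algebra S)"
    and merge: "\<And>P i j. \<lbrakk>P \<subseteq> b; {i, j} \<in> b; {i, j} \<notin> P\<rbrakk> \<Longrightarrow> component P (Upper, i) \<noteq> component P (Lower, i)"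
  shows "surgeries n c b a ori ps P (exterior_map (circ P) (\<lambda>s. component P (\<kappa> s)) X) =
    exterior_map (circ (surgered P ps)) (\<lambda>s. component (surgered P ps) (\<kappa> s)) X"
  using assms(1-3)
proof (induction ps arbitrary: P)
  case Nil
  then show ?case by simp
next
  case (Cons p ps)
  from Cons.prems show ?case
  proof (cases rule: surgeries_step)
    case skip
    show ?thesis unfolding skip using Cons by simp
  next
    case (surger i j)
    note step = surgery_map_comp[OF Cons.prems(3) surger(1,2) merge[OF Cons.prems(3) surger(1,2)] \<kappa> X]
    show ?thesis unfolding surger(3,4) comp_apply step
      by (rule Cons.IH) (use Cons.prems surger(1) in auto)
  qed
qed


section \<open>The first and the last diagram\<close>

lemma edge_points: "{x, y} \<in> c \<union> b \<union> a \<Longrightarrow> x \<in> {1..2 * n} \<and> y \<in> {1..2 * n}"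
  using perfect_matchingD(4)[OF c] perfect_matchingD(4)[OF b] perfect_matchingD(4)[OF a] by blast

text \<open>Before any surgery there are no vertical edges, so a walk stays on its level.\<close>

lemma comp_empty:
  "component {} (Upper, v) = Pair Upper ` connected_comp (c \<union> b) v"
  "component {} (Lower, v) = Pair Lower ` connected_comp (b \<union> a) v"
proof -
  have U: "{(Upper, x), (\<epsilon>, y)} \<in> diagram c b a {} \<longleftrightarrow> \<epsilon> = Upper \<and> {x, y} \<in> c \<union> b" for x y \<epsilon>
    by (cases \<epsilon>) (auto simp: diagram_eq vertical_def horizontal_edge dest: horizontal_cases)
  have L: "{(Lower, x), (\<epsilon>, y)} \<in> diagram c b a {} \<longleftrightarrow> \<epsilon> = Lower \<and> {x, y} \<in> b \<union> a" for x y \<epsilon>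
    by (cases \<epsilon>) (auto simp: diagram_eq vertical_def horizontal_edge dest: horizontal_cases)
  show "component {} (Upper, v) = Pair Upper ` connected_comp (c \<union> b) v"
    by (rule connected_comp_image) (use U in auto)
  show "component {} (Lower, v) = Pair Lower ` connected_comp (b \<union> a) v"
    by (rule connected_comp_image) (use L in auto)
qed

lemma circ_empty:
  "circ {} = (`) (Pair Upper) ` circles n c b \<union> (`) (Pair Lower) ` circles n b a"
proof -
  have "UNIV \<times> {1..2 * n} = Pair Upper ` {1..2 * n} \<union> Pair Lower ` {1..2 * n}"
    by (auto simp: level_UNIV)
  then show ?thesis
    by (simp add: diagram_circles_def connected_comps_def circles_def image_Un image_image comp_empty)
qed

lemma card_circ_empty: "card (circ {}) = card (circles n c b) + card (circles n b a)"
proof -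
  have "(`) (Pair Upper) ` circles n c b \<inter> (`) (Pair Lower) ` circles n b a = {}"
  proof -
    have "Pair Upper ` s \<noteq> Pair Lower ` t" if s: "s \<in> circles n c b" for s t :: "nat set"
    proof
      assume eq: "Pair Upper ` s = Pair Lower ` t"
      obtain v where "s = connected_comp (c \<union> b) v"
        using s unfolding circles_def connected_comps_def by (elim imageE)
      then have "v \<in> s" by simp
      then have "(Upper, v) \<in> Pair Lower ` t" unfolding eq[symmetric] by simp
      then show False by auto
    qed
    then show ?thesis by blast
  qed
  then have "card (circ {}) = card ((`) (Pair Upper) ` circles n c b) + card ((`) (Pair Lower) ` circles n b a)"
    unfolding circ_empty
    by (intro card_Un_disjoint) (auto simp: circles_def connected_comps_def)
  then show ?thesis by (simp add: card_image[OF inj_on_subset[OF inj_image_Pair subset_UNIV]])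
qed

text \<open>After all surgeries there is a vertical edge over every point and no copy of an arc of
  \<open>b\<close>; contracting the vertical edges gives the graph
  \<open>c \<union> a\<close>.\<close>

lemma comp_b:
  assumes "v \<in> {1..2 * n}"
  shows "component b (\<epsilon>, v) = UNIV \<times> connected_comp (c \<union> a) v"
proof
  have V: "\<Union>b = {1..2 * n}" using perfect_matchingD(1)[OF b] .
  have v: "{(\<delta>, x), (\<delta>', x)} \<in> diagram c b a b" if "\<delta> \<noteq> \<delta>'" "x \<in> {1..2 * n}" for \<delta> \<delta>' x
    using that by (simp add: diagram_eq vertical_edge V)
  show "component b (\<epsilon>, v) \<subseteq> UNIV \<times> connected_comp (c \<union> a) v"
  proof (rule connected_comp_least)
    fix x y assume x: "x \<in> UNIV \<times> connected_comp (c \<union> a) v" and xy: "{x, y} \<in> diagram c b a b"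
    obtain \<epsilon> x' \<delta> y' where [simp]: "x = (\<epsilon>, x')" "y = (\<delta>, y')" by fastforce
    have "x' = y' \<or> {x', y'} \<in> c \<union> a"
      using xy horizontal_cases[of \<epsilon> x' \<delta> y' c a]
      by (auto simp: diagram_eq vertical_edge horizontal_def split: if_splits)
    then show "y \<in> UNIV \<times> connected_comp (c \<union> a) v" using x connected_comp_closed[of x' "c \<union> a" v y'] by auto
  qed simp
  \<comment> \<open>Both levels are carried along, because arcs of \<open>c\<close> run on the upper
    and arcs of \<open>a\<close> on the lower level.\<close>
  have "connected_comp (c \<union> a) v \<subseteq> {w \<in> {1..2 * n}. \<forall>\<delta>. (\<delta>, w) \<in> component b (\<epsilon>, v)}"
  proof (rule connected_comp_least)
    have "(\<delta>, v) \<in> component b (\<epsilon>, v)" for \<delta>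
      using connected_comp_edge[OF v[of \<epsilon> \<delta>]] assms by (cases "\<epsilon> = \<delta>") auto
    then show "v \<in> {w \<in> {1..2 * n}. \<forall>\<delta>. (\<delta>, w) \<in> component b (\<epsilon>, v)}"
      using assms by simp
    fix x y assume x: "x \<in> {w \<in> {1..2 * n}. \<forall>\<delta>. (\<delta>, w) \<in> component b (\<epsilon>, v)}" and xy: "{x, y} \<in> c \<union> a"
    have y: "y \<in> {1..2 * n}" using edge_points xy by blast
    obtain \<delta> where "{(\<delta>, x), (\<delta>, y)} \<in> diagram c b a b"
      using xy horizontal_edge[of x y c a] by (auto simp: diagram_eq)
    moreover have "(\<delta>, x) \<in> component b (\<epsilon>, v)" using x by blast
    ultimately have \<delta>: "(\<delta>, y) \<in> component b (\<epsilon>, v)" by (rule connected_comp_closed[rotated])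
    then have "(\<delta>', y) \<in> component b (\<epsilon>, v)" for \<delta>'
      using connected_comp_closed[OF \<delta> v[of \<delta> \<delta>' y]] y by (cases "\<delta> = \<delta>'") auto
    then show "y \<in> {w \<in> {1..2 * n}. \<forall>\<delta>. (\<delta>, w) \<in> component b (\<epsilon>, v)}" using y by simp
  qed
  then show "UNIV \<times> connected_comp (c \<union> a) v \<subseteq> component b (\<epsilon>, v)" by auto
qed

lemma circ_b: "circ b = (\<times>) UNIV ` circles n c a"
  by (force simp: diagram_circles_def connected_comps_def circles_def comp_b image_iff)

lemma snd_circ_b: "(`) snd ` circ b \<subseteq> circles n c a"
  by (auto simp: circ_b image_image)

lemma card_circ_b: "card (circ b) = card (circles n c a)"
proof -
  have "inj_on ((\<times>) (UNIV :: level set)) (circles n c a)"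
    by (rule inj_onI) auto
  then show ?thesis by (simp add: circ_b card_image)
qed

end


section \<open>Enumerating a linear order\<close>

lemma sorted_wrt_unique:
  assumes "antisym r" "sorted_wrt (\<lambda>x y. (x, y) \<in> r) xs" "sorted_wrt (\<lambda>x y. (x, y) \<in> r) ys"
    and "distinct xs" "distinct ys" "set xs = set ys"
  shows "xs = ys"
  using assms(2-)
proof (induction xs arbitrary: ys)
  case Nil
  then show ?case by simp
next
  case (Cons x xs)
  then obtain y ys' where ys: "ys = y # ys'" by (cases ys) auto
  have "x = y \<or> (x, y) \<in> r \<and> (y, x) \<in> r" using Cons.prems unfolding ys by auto
  then have "x = y" using assms(1) by (auto dest: antisymD)
  moreover have "xs = ys'"
    using Cons.prems \<open>x = y\<close> unfolding ys by (intro Cons.IH) auto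
  ultimately show ?case by (simp add: ys)
qed

text \<open>Stated for subsets \<open>B\<close> of \<open>A\<close>, so that the induction on
  \<open>B\<close> can keep one and the same order on \<open>A\<close>.\<close>

lemma linear_order_list_exists:
  assumes r: "linear_order_on A r" and "finite B" "B \<subseteq> A"
  shows "\<exists>xs. set xs = B \<and> distinct xs \<and> sorted_wrt (\<lambda>x y. (x, y) \<in> r) xs"
  using assms(2,3)
proof (induction B rule: finite_induct)
  case empty
  then show ?case by simp
next
  case (insert x B)
  then obtain ys where ys: "set ys = B" "distinct ys" "sorted_wrt (\<lambda>x y. (x, y) \<in> r) ys" by auto
  have tot: "(x, y) \<in> r" if "y \<in> B" "(y, x) \<notin> r" for y
    using r that insert.hyps(2) insert.prems
    by (auto simp: linear_order_on_def total_on_def)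
  have tr: "(y, z) \<in> r" if "(y, x) \<in> r" "(x, z) \<in> r" for y z
    using r that by (auto simp: linear_order_on_def partial_order_on_def preorder_on_def dest: transD)
  \<comment> \<open>Insertion sort: \<open>x\<close> goes between the elements before it and the
    elements after it.\<close>
  let ?xs = "filter (\<lambda>y. (y, x) \<in> r) ys @ x # filter (\<lambda>y. (y, x) \<notin> r) ys"
  have "set ?xs = insert x B" "distinct ?xs" using ys insert.hyps by auto
  moreover have "sorted_wrt (\<lambda>x y. (x, y) \<in> r) ?xs"
    using ys tot tr by (auto simp: sorted_wrt_append intro: sorted_wrt_filter)
  ultimately show ?case by blast
qed

lemma set_enumerate_order:
  assumes "linear_order_on A r" "finite A"
  shows "set (enumerate_order A r) = A"
proof -
  have "\<exists>!xs. set xs = A \<and> distinct xs \<and> sorted_wrt (\<lambda>x y. (x, y) \<in> r) xs"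
    using linear_order_list_exists[OF assms subset_refl] sorted_wrt_unique[of r] assms(1)
    by (auto simp: linear_order_on_def partial_order_on_def)
  from theI'[OF this] show ?thesis by (simp add: enumerate_order_def)
qed


section \<open>Additivity, degree and units for the product of two summands\<close>

section \<open>The product on the summands\<close>

lemma exterior_map_cong:
  assumes "X \<in> carrier (exterior_algebra S)" "\<And>s. s \<in> S \<Longrightarrow> f s = g s" "f ` S \<subseteq> S'"
  shows "exterior_map S' f X = exterior_map S' g X"
  using exterior_map_comp[of id S S f S' X g] exterior_map_id[OF assms(1), of id] assms by auto

lemma hom_add_zero:
  assumes "ring A" "ring B" "h \<in> hom (add_monoid A) (add_monoid B)"
  shows "h \<zero>\<^bsub>A\<^esub> = \<zero>\<^bsub>B\<^esub>"
  using hom_one[OF assms(3) abelian_group.a_group[OF ring.is_abelian_group[OF assms(1)]]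
      abelian_group.a_group[OF ring.is_abelian_group[OF assms(2)]]] by simp

lemma hom_add_finsum:
  assumes "ring A" "ring B" and h: "h \<in> hom (add_monoid A) (add_monoid B)"
    and "finite D" "f \<in> D \<rightarrow> carrier A"
  shows "h (\<Oplus>\<^bsub>A\<^esub>d\<in>D. f d) = (\<Oplus>\<^bsub>B\<^esub>d\<in>D. h (f d))"
proof -
  interpret A: ring A by fact
  interpret B: ring B by fact
  have add: "h (x \<oplus>\<^bsub>A\<^esub> y) = h x \<oplus>\<^bsub>B\<^esub> h y" if "x \<in> carrier A" "y \<in> carrier A" for x y
    using hom_mult[OF h] that by simp
  have cl: "h x \<in> carrier B" if "x \<in> carrier A" for x
    using hom_in_carrier[OF h] that by simp
  show ?thesis using assms(4,5)
  proof (induction D rule: finite_induct)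
    case empty
    then show ?case using hom_add_zero[OF assms(1-3)] by simp
  next
    case (insert d D)
    then show ?case by (simp add: add cl Pi_iff)
  qed
qed

context three_matchings
begin

lemma circle_maps:
  "(`) (Pair Upper) ` circles n c b \<subseteq> circ {}" "(`) (Pair Lower) ` circles n b a \<subseteq> circ {}"
  by (auto simp: circ_empty)

text \<open>\<open>mult_cba\<close> with the list of points and the orientations as parameters,
  separated from the rule that provides them.\<close>

definition product ::
    "nat list \<Rightarrow> (nat set \<Rightarrow> nat \<times> nat) \<Rightarrow> (nat set list \<Rightarrow>\<^sub>0 int) set \<Rightarrow> (nat set list \<Rightarrow>\<^sub>0 int) set \<Rightarrow>
      (nat set list \<Rightarrow>\<^sub>0 int) set"
  where "product ps ori x y = exterior_map (circles n c a) ((`) snd) (surgeries n c b a ori ps {}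
    (exterior_map (circ {}) ((`) (Pair Upper)) x \<otimes>\<^bsub>exterior_algebra (circ {})\<^esub>
     exterior_map (circ {}) ((`) (Pair Lower)) y))"

context
  fixes ps ori
  assumes ps: "set ps = {1..2 * n}" and ori: "ori \<in> arc_orientations b"
begin

lemma surgered_all: "surgered {} ps = b"
proof -
  have "A \<inter> {1..2 * n} \<noteq> {}" if "A \<in> b" for A
  proof -
    have "A \<noteq> {}" using perfect_matchingD(3)[OF b that] by auto
    then show ?thesis using perfect_matchingD(4)[OF b that] by blast
  qed
  then show ?thesis unfolding ps by blast
qed

lemma final_hom:
  "exterior_map (circles n c a) ((`) snd) \<circ> surgeries n c b a ori ps {}
    \<in> hom (add_monoid (exterior_algebra (circ {}))) (add_monoid (exterior_algebra (circles n c a)))"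
proof (rule hom_compose)
  show "surgeries n c b a ori ps {}
      \<in> hom (add_monoid (exterior_algebra (circ {}))) (add_monoid (exterior_algebra (circ b)))"
    using surgeries_hom[of ps ori "{}"] surgered_all ps ori by simp
qed (rule exterior_map_hom[OF snd_circ_b])

lemma product_hom_left:
  assumes "y \<in> carrier (exterior_algebra (circles n b a))"
  shows "(\<lambda>x. product ps ori x y)
    \<in> hom (add_monoid (exterior_algebra (circles n c b))) (add_monoid (exterior_algebra (circles n c a)))"
proof -
  interpret R: ring "exterior_algebra (circ {})" by (rule ring_exterior_algebra)
  let ?y = "exterior_map (circ {}) ((`) (Pair Lower)) y"
  have "?y \<in> carrier (exterior_algebra (circ {}))"
    using hom_in_carrier[OF exterior_map_hom[OF circle_maps(2)]] assms by simp
  then have "(\<lambda>x. x \<otimes>\<^bsub>exterior_algebra (circ {})\<^esub> ?y)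
      \<in> hom (add_monoid (exterior_algebra (circ {}))) (add_monoid (exterior_algebra (circ {})))"
    by (intro homI) (auto simp: R.l_distr)
  from hom_compose[OF hom_compose[OF exterior_map_hom[OF circle_maps(1)] this] final_hom]
  show ?thesis by (simp add: comp_def product_def)
qed

lemma product_hom_right:
  assumes "x \<in> carrier (exterior_algebra (circles n c b))"
  shows "product ps ori x
    \<in> hom (add_monoid (exterior_algebra (circles n b a))) (add_monoid (exterior_algebra (circles n c a)))"
proof -
  interpret R: ring "exterior_algebra (circ {})" by (rule ring_exterior_algebra)
  let ?x = "exterior_map (circ {}) ((`) (Pair Upper)) x"
  have "?x \<in> carrier (exterior_algebra (circ {}))"
    using hom_in_carrier[OF exterior_map_hom[OF circle_maps(1)]] assms by simp
  then have "(\<lambda>y. ?x \<otimes>\<^bsub>exterior_algebra (circ {})\<^esub> y)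
      \<in> hom (add_monoid (exterior_algebra (circ {}))) (add_monoid (exterior_algebra (circ {})))"
    by (intro homI) (auto simp: R.r_distr)
  from hom_compose[OF hom_compose[OF exterior_map_hom[OF circle_maps(2)] this] final_hom]
  show ?thesis by (simp add: comp_def product_def[abs_def])
qed

text \<open>The shift by \<open>n\<close> occurs in the degree of each factor but only once in that
  of the product. The \<open>n\<close> surgeries, one for each arc of \<open>b\<close>, make up for
  the difference.\<close>

lemma product_part:
  assumes x: "x \<in> exterior_part (circles n c b) (\<lambda>k. 2 * int k + int n - int (card (circles n c b)) = d)"
    and y: "y \<in> exterior_part (circles n b a) (\<lambda>k. 2 * int k + int n - int (card (circles n b a)) = e)"
  shows "product ps ori x y
    \<in> exterior_part (circles n c a) (\<lambda>k. 2 * int k + int n - int (card (circles n c a)) = d + e)"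
proof -
  have card_b: "card b = n" using perfect_matching_card[OF b] by simp
  let ?xy = "exterior_map (circ {}) ((`) (Pair Upper)) x \<otimes>\<^bsub>exterior_algebra (circ {})\<^esub>
     exterior_map (circ {}) ((`) (Pair Lower)) y"
  have "?xy \<in> exterior_part (circ {}) (\<lambda>k. 2 * int k - int (card (circ {})) = d + e - 2 * int n)"
    by (rule exterior_part_mult[OF exterior_map_part[OF x circle_maps(1)]
          exterior_map_part[OF y circle_maps(2)]]) (auto simp: card_circ_empty)
  from surgeries_part[OF _ ori empty_subsetI this, of ps]
  have "surgeries n c b a ori ps {} ?xy \<in> exterior_part (circ b)
      (\<lambda>k. 2 * int k - int (card (circ b)) = d + e - 2 * int n + int (card b) - int (card {}))"
    unfolding surgered_all using ps by simp
  then have "surgeries n c b a ori ps {} ?xy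
      \<in> exterior_part (circ b) (\<lambda>k. 2 * int k - int (card (circles n c a)) = d + e - int n)"
    unfolding card_b card_circ_b by (rule exterior_part_mono) simp
  from exterior_map_part[OF this snd_circ_b] show ?thesis
    unfolding product_def by (rule exterior_part_mono) simp
qed

text \<open>
  A merge sends the circle through a point to the new circle through the same point, so a composite
  of merges is tracked by a choice of one point on each circle.
\<close>

lemma all_merges:
  assumes merge: "\<And>P i j. \<lbrakk>P \<subseteq> b; {i, j} \<in> b; {i, j} \<notin> P\<rbrakk> \<Longrightarrow>
      component P (Upper, i) \<noteq> component P (Lower, i)"
    and X: "X \<in> carrier (exterior_algebra (circles n c a))"
    and f: "f ` circles n c a \<subseteq> circ {}"
      "\<And>v. v \<in> {1..2 * n} \<Longrightarrow> f (connected_comp (c \<union> a) v) = component {} (\<epsilon>, v)"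
  shows "exterior_map (circles n c a) ((`) snd)
      (surgeries n c b a ori ps {} (exterior_map (circ {}) f X)) = X"
proof -
  \<comment> \<open>A vertex on each circle, placed on the level from which \<open>X\<close> enters
    the diagram.\<close>
  define \<kappa> where "\<kappa> s = (\<epsilon>, SOME v. v \<in> {1..2 * n} \<and> s = connected_comp (c \<union> a) v)" for s
  have \<kappa>: "\<exists>v. v \<in> {1..2 * n} \<and> s = connected_comp (c \<union> a) v \<and> \<kappa> s = (\<epsilon>, v)"
    if "s \<in> circles n c a" for s
  proof -
    have "\<exists>v. v \<in> {1..2 * n} \<and> s = connected_comp (c \<union> a) v"
      using that unfolding circles_def connected_comps_def by blast
    from someI_ex[OF this] show ?thesis unfolding \<kappa>_def by blast
  qed
  have f': "f s = component {} (\<kappa> s)" if "s \<in> circles n c a" for s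
    using \<kappa>[OF that] f(2) by auto
  have \<kappa>V: "\<kappa> ` circles n c a \<subseteq> UNIV \<times> {1..2 * n}"
    using \<kappa> by fastforce
  have snd: "snd ` component b (\<kappa> s) = s" if "s \<in> circles n c a" for s
    using \<kappa>[OF that] comp_b by (auto simp: snd_image_times)
  have "exterior_map (circ {}) f X = exterior_map (circ {}) (\<lambda>s. component {} (\<kappa> s)) X"
    using f' f(1) by (rule exterior_map_cong[OF X])
  then have "surgeries n c b a ori ps {} (exterior_map (circ {}) f X) =
      exterior_map (circ b) (\<lambda>s. component b (\<kappa> s)) X"
    using surgeries_merges[OF _ ori empty_subsetI \<kappa>V X merge, of ps] surgered_all ps by simp
  \<comment> \<open>Forgetting the level undoes the doubling in \<open>comp_b\<close>, so the
    composite is induced by the identity.\<close>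
  also have "exterior_map (circles n c a) ((`) snd) \<dots> = exterior_map (circles n c a) id X"
  proof (rule exterior_map_comp[OF _ snd_circ_b X])
    show "(\<lambda>s. component b (\<kappa> s)) ` circles n c a \<subseteq> circ b"
      using \<kappa>V by (auto simp: diagram_circles_def connected_comps_def)
  qed (simp add: snd)
  finally show ?thesis by (simp add: exterior_map_id[OF X])
qed

text \<open>On a level where both matchings are \<open>b\<close>, an arc not yet surgered is doubled
  and closes up to a circle of its own, which surgeries along other arcs do not reach.\<close>

lemma isolated_arc:
  assumes "P \<subseteq> b" "{i, j} \<in> b" "{i, j} \<notin> P" and \<epsilon>: "\<epsilon> = Upper \<and> c = b \<or> \<epsilon> = Lower \<and> a = b"
  shows "component P (\<epsilon>, i) \<subseteq> {(\<epsilon>, i), (\<epsilon>, j)}"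
proof (rule connected_comp_least)
  have uniq: "B = {i, j}" if "B \<in> b" "x \<in> B" "x \<in> {i, j}" for B x
    using perfect_matching_unique[OF b that(1) assms(2)] that by blast
  fix p q assume p: "p \<in> {(\<epsilon>, i), (\<epsilon>, j)}" and pq: "{p, q} \<in> diagram c b a P"
  obtain x \<delta> y where xy: "p = (\<epsilon>, x)" "q = (\<delta>, y)" "x \<in> {i, j}" using p by (cases q) auto
  have "x \<notin> \<Union>P" using uniq[of _ x] xy(3) assms(1,3) by blast
  then have "{(\<epsilon>, x), (\<delta>, y)} \<in> horizontal c a \<or> {(\<epsilon>, x), (\<delta>, y)} \<in> horizontal (b - P) (b - P)"
    using pq unfolding xy diagram_eq by (auto simp: vertical_edge)
  then have "\<epsilon> = \<delta> \<and> {x, y} \<in> b"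
    using horizontal_cases[of \<epsilon> x \<delta> y c a] horizontal_cases[of \<epsilon> x \<delta> y "b - P" "b - P"] \<epsilon>
    by (auto split: if_splits)
  then show "q \<in> {(\<epsilon>, i), (\<epsilon>, j)}" using uniq[of "{x, y}" x] xy by auto
qed simp

text \<open>One of the two circles is confined to its own level by \<open>isolated_arc\<close> and
  so misses the other copy of \<open>i\<close>.\<close>

lemma arc_copies_distinct:
  assumes "P \<subseteq> b" "{i, j} \<in> b" "{i, j} \<notin> P" and "c = b \<or> a = b"
  shows "component P (Upper, i) \<noteq> component P (Lower, i)"
  using isolated_arc[OF assms(1-3)] assms(4) connected_comp_self[of "(Upper, i)"]
    connected_comp_self[of "(Lower, i)"] by blast

text \<open>The unit becomes the unit over the first diagram, so only the image of \<open>x\<close>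
  on the upper level has to be followed through the merges.\<close>

lemma product_one_right:
  assumes "a = b" "x \<in> carrier (exterior_algebra (circles n c a))"
  shows "product ps ori x \<one>\<^bsub>exterior_algebra (circles n b a)\<^esub> = x"
proof -
  interpret R: ring "exterior_algebra (circ {})" by (rule ring_exterior_algebra)
  have merge: "component P (Upper, i) \<noteq> component P (Lower, i)"
    if "P \<subseteq> b" "{i, j} \<in> b" "{i, j} \<notin> P" for P i j
    using arc_copies_distinct[OF that] assms(1) by blast
  have m: "exterior_map (circles n c a) ((`) snd)
      (surgeries n c b a ori ps {} (exterior_map (circ {}) ((`) (Pair Upper)) x)) = x"
  proof (rule all_merges[where f = "(`) (Pair Upper)" and \<epsilon> = Upper])
    show "component P (Upper, i) \<noteq> component P (Lower, i)"
      if "P \<subseteq> b" "{i, j} \<in> b" "{i, j} \<notin> P" for P i j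
      using that by (rule merge)
  qed (use circle_maps(1) comp_empty(1) assms in auto)
  have "exterior_map (circ {}) ((`) (Pair Upper)) x \<in> carrier (exterior_algebra (circ {}))"
    using hom_in_carrier[OF exterior_map_hom[OF circle_maps(1)]] assms by simp
  then show ?thesis
    unfolding product_def exterior_map_one[OF circle_maps(2)]
    using m by simp
qed

lemma product_one_left:
  assumes "c = b" "y \<in> carrier (exterior_algebra (circles n c a))"
  shows "product ps ori \<one>\<^bsub>exterior_algebra (circles n c b)\<^esub> y = y"
proof -
  interpret R: ring "exterior_algebra (circ {})" by (rule ring_exterior_algebra)
  have merge: "component P (Upper, i) \<noteq> component P (Lower, i)"
    if "P \<subseteq> b" "{i, j} \<in> b" "{i, j} \<notin> P" for P i j
    using arc_copies_distinct[OF that] assms(1) by blast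
  have m: "exterior_map (circles n c a) ((`) snd)
      (surgeries n c b a ori ps {} (exterior_map (circ {}) ((`) (Pair Lower)) y)) = y"
  proof (rule all_merges[where f = "(`) (Pair Lower)" and \<epsilon> = Lower])
    show "component P (Upper, i) \<noteq> component P (Lower, i)"
      if "P \<subseteq> b" "{i, j} \<in> b" "{i, j} \<notin> P" for P i j
      using that by (rule merge)
  qed (use circle_maps(2) comp_empty(2) assms in auto)
  have "exterior_map (circ {}) ((`) (Pair Lower)) y \<in> carrier (exterior_algebra (circ {}))"
    using hom_in_carrier[OF exterior_map_hom[OF circle_maps(2)]] assms by simp
  then show ?thesis
    unfolding product_def exterior_map_one[OF circle_maps(1)]
    using m by simp
qed

end

end


section \<open>Assembling the summands into a unital ring\<close>

section \<open>The ring\<close>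

lemma finite_crossingless_matchings: "finite (crossingless_matchings n)"
proof (rule finite_subset)
  show "crossingless_matchings n \<subseteq> Pow (Pow {1..2 * n})"
    using perfect_matchingD(4)[OF crossingless_matchingD] by blast
qed simp

lemma b_OH_a_deg_eq:
  "b_OH_a_deg n (b, a) d =
    exterior_part (circles n b a) (\<lambda>k. 2 * int k + int n - int (card (circles n b a)) = d)"
  by (auto simp: b_OH_a_deg_def exterior_part_def)

lemma b_OH_a_eq: "b_OH_a n (b, a) = exterior_algebra (circles n b a)"
  by (simp add: b_OH_a_def)

lemma ring_b_OH_a: "ring (b_OH_a n p)"
  by (cases p) (simp add: b_OH_a_eq ring_exterior_algebra)

lemma b_OH_a_one_zero_closed [simp]:
  "\<one>\<^bsub>b_OH_a n p\<^esub> \<in> carrier (b_OH_a n p)" "\<zero>\<^bsub>b_OH_a n p\<^esub> \<in> carrier (b_OH_a n p)"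
  using ring.ring_simprules(2,6)[OF ring_b_OH_a] by auto

lemma comm_group_b_OH_a: "comm_group (add_monoid (b_OH_a n p))"
  by (rule abelian_group.a_comm_group[OF ring.is_abelian_group[OF ring_b_OH_a]])

locale OH_rule =
  fixes n C
  assumes C: "C \<in> mult_rules n"
begin

abbreviation "cm \<equiv> crossingless_matchings n"
abbreviation "R \<equiv> OH n C"

text \<open>Unpacks the rule at \<open>(c, b, a)\<close> so that the results on
  \<open>product\<close> become available.\<close>

lemma mult_cba_product:
  assumes "c \<in> cm" "b \<in> cm" "a \<in> cm"
  obtains ps ori where "three_matchings n c b a" "set ps = {1..2 * n}" "ori \<in> arc_orientations b"
    "mult_cba n C c b a = three_matchings.product n c b a ps ori"
proof -
  obtain r ori where ro: "C (c, b, a) = (r, ori)" by fastforce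
  have "C (c, b, a) \<in> rule_orders n b \<times> arc_orientations b"
    using C assms by (auto simp: mult_rules_def PiE_iff)
  then have r: "linear_order_on {1..2 * n} r" and ori: "ori \<in> arc_orientations b"
    by (auto simp: ro rule_orders_def)
  have tm: "three_matchings n c b a"
    using assms crossingless_matchingD by (intro three_matchings.intro) auto
  show thesis
    by (rule that[OF tm set_enumerate_order[OF r] ori])
       (simp_all add: fun_eq_iff mult_cba_def ro Let_def three_matchings.product_def[OF tm])
qed

text \<open>\<open>sum_group\<close> consists of families of finite support; here the index set
  itself is finite.\<close>

lemma carrier_OH: "carrier R = (\<Pi>\<^sub>E p\<in>cm \<times> cm. carrier (b_OH_a n p))"
proof -
  have "carrier (OH_group n) = {x \<in> \<Pi>\<^sub>E p\<in>cm \<times> cm. carrier (add_monoid (b_OH_a n p)).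
      finite {p \<in> cm \<times> cm. x p \<noteq> \<one>\<^bsub>add_monoid (b_OH_a n p)\<^esub>}}"
    unfolding OH_group_def
    by (rule carrier_sum_group) (rule comm_group.axioms(2)[OF comm_group_b_OH_a])
  then show ?thesis using finite_crossingless_matchings[of n] by (simp add: OH_def)
qed

lemma add_OH: "x \<oplus>\<^bsub>R\<^esub> y = (\<lambda>p\<in>cm \<times> cm. x p \<oplus>\<^bsub>b_OH_a n p\<^esub> y p)"
  by (simp add: OH_def OH_group_def)

lemma zero_OH: "\<zero>\<^bsub>R\<^esub> = (\<lambda>p\<in>cm \<times> cm. \<zero>\<^bsub>b_OH_a n p\<^esub>)"
  by (simp add: OH_def OH_group_def)

lemma mult_OH: "x \<otimes>\<^bsub>R\<^esub> y = (\<lambda>(c, a)\<in>cm \<times> cm.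
    \<Oplus>\<^bsub>b_OH_a n (c, a)\<^esub>b\<in>cm. mult_cba n C c b a (x (c, b)) (y (b, a)))"
  by (simp add: OH_def)

lemma component_carrier: "\<lbrakk>x \<in> carrier R; p \<in> cm \<times> cm\<rbrakk> \<Longrightarrow> x p \<in> carrier (b_OH_a n p)"
  unfolding carrier_OH by blast

lemma carrier_OH_I:
  "\<lbrakk>\<And>p. p \<in> cm \<times> cm \<Longrightarrow> x p \<in> carrier (b_OH_a n p); x \<in> extensional (cm \<times> cm)\<rbrakk> \<Longrightarrow> x \<in> carrier R"
  unfolding carrier_OH PiE_iff by blast

lemma OH_eqI:
  "\<lbrakk>x \<in> carrier R; y \<in> carrier R; \<And>p. p \<in> cm \<times> cm \<Longrightarrow> x p = y p\<rbrakk> \<Longrightarrow> x = y"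
  unfolding carrier_OH by (rule PiE_ext)

lemma add_monoid_OH: "add_monoid R = OH_group n"
  by (simp add: OH_def)

sublocale abelian_group R
proof (rule comm_group_abelian_groupI)
  have "group (OH_group n)"
    unfolding OH_group_def by (rule sum_group) (rule comm_group.axioms(2)[OF comm_group_b_OH_a])
  then show "comm_group (add_monoid R)"
    unfolding add_monoid_OH
  proof (rule group.group_comm_groupI)
    fix x y assume "x \<in> carrier (OH_group n)" "y \<in> carrier (OH_group n)"
    then have xy: "x \<in> carrier R" "y \<in> carrier R" by (auto simp: OH_def)
    have "x p \<oplus>\<^bsub>b_OH_a n p\<^esub> y p = y p \<oplus>\<^bsub>b_OH_a n p\<^esub> x p" if "p \<in> cm \<times> cm" for p
      using abelian_monoid.a_comm[OF abelian_group.axioms(1)[OF ring.is_abelian_group[OF ring_b_OH_a]]]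
        component_carrier xy that by blast
    then have "x \<oplus>\<^bsub>R\<^esub> y = y \<oplus>\<^bsub>R\<^esub> x" unfolding add_OH by (intro restrict_ext)
    then show "x \<otimes>\<^bsub>OH_group n\<^esub> y = y \<otimes>\<^bsub>OH_group n\<^esub> x" by (simp add: OH_def)
  qed
qed

lemma finsum_OH:
  assumes "finite D" "f \<in> D \<rightarrow> carrier R" "p \<in> cm \<times> cm"
  shows "(\<Oplus>\<^bsub>R\<^esub>d\<in>D. f d) p = (\<Oplus>\<^bsub>b_OH_a n p\<^esub>d\<in>D. f d p)"
  using assms(1,2)
proof (induction D rule: finite_induct)
  interpret B: ring "b_OH_a n p" by (rule ring_b_OH_a)
  case empty
  show ?case using assms(3) by (simp add: zero_OH)
next
  interpret B: ring "b_OH_a n p" by (rule ring_b_OH_a)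
  case (insert d D)
  have "(\<Oplus>\<^bsub>R\<^esub>d\<in>insert d D. f d) p = (f d \<oplus>\<^bsub>R\<^esub> (\<Oplus>\<^bsub>R\<^esub>d\<in>D. f d)) p"
    using insert by simp
  also have "\<dots> = f d p \<oplus>\<^bsub>b_OH_a n p\<^esub> (\<Oplus>\<^bsub>b_OH_a n p\<^esub>d\<in>D. f d p)"
    using insert assms(3) by (simp add: add_OH)
  also have "\<dots> = (\<Oplus>\<^bsub>b_OH_a n p\<^esub>d\<in>insert d D. f d p)"
    using insert assms(3) component_carrier by (intro B.finsum_insert[symmetric]) (auto simp: Pi_iff)
  finally show ?case .
qed

lemma OH_idem_closed: "OH_idem n a \<in> carrier R"
proof (rule carrier_OH_I)
  fix p assume "p \<in> cm \<times> cm"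
  then show "OH_idem n a p \<in> carrier (b_OH_a n p)" by (simp add: OH_idem_def split: if_split)
qed (simp add: OH_idem_def)

lemma one_OH: "\<one>\<^bsub>R\<^esub> = (\<Oplus>\<^bsub>R\<^esub>a\<in>cm. OH_idem n a)"
  unfolding finsum_def add_monoid_OH by (simp add: OH_def)

lemma one_closed_OH: "\<one>\<^bsub>R\<^esub> \<in> carrier R"
  unfolding one_OH by (rule finsum_closed) (use OH_idem_closed in auto)

lemma one_OH_apply:
  assumes "b \<in> cm" "a \<in> cm"
  shows "\<one>\<^bsub>R\<^esub> (b, a) = (if b = a then \<one>\<^bsub>b_OH_a n (b, a)\<^esub> else \<zero>\<^bsub>b_OH_a n (b, a)\<^esub>)"
proof -
  interpret B: ring "b_OH_a n (b, a)" by (rule ring_b_OH_a)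
  have "\<one>\<^bsub>R\<^esub> (b, a) = (\<Oplus>\<^bsub>b_OH_a n (b, a)\<^esub>d\<in>cm. OH_idem n d (b, a))"
    unfolding one_OH using assms OH_idem_closed finite_crossingless_matchings
    by (intro finsum_OH) auto
  \<comment> \<open>Only \<open>d = a\<close> can contribute. The remaining condition
    \<open>b = a\<close> does not depend on \<open>d\<close> and is moved into the one term that
    \<open>finsum_singleton\<close> picks out.\<close>
  also have "\<dots> = (\<Oplus>\<^bsub>b_OH_a n (b, a)\<^esub>d\<in>cm. if a = d
      then (if b = a then \<one>\<^bsub>b_OH_a n (b, a)\<^esub> else \<zero>\<^bsub>b_OH_a n (b, a)\<^esub>) else \<zero>\<^bsub>b_OH_a n (b, a)\<^esub>)"
    by (rule B.finsum_cong'[OF refl]) (use assms in \<open>auto simp: OH_idem_def\<close>)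
  also have "\<dots> = (if b = a then \<one>\<^bsub>b_OH_a n (b, a)\<^esub> else \<zero>\<^bsub>b_OH_a n (b, a)\<^esub>)"
    by (rule B.finsum_singleton) (use assms finite_crossingless_matchings in auto)
  finally show ?thesis .
qed

lemma mult_cba_hom_left:
  assumes "c \<in> cm" "b \<in> cm" "a \<in> cm" "y \<in> carrier (b_OH_a n (b, a))"
  shows "(\<lambda>x. mult_cba n C c b a x y) \<in> hom (add_monoid (b_OH_a n (c, b))) (add_monoid (b_OH_a n (c, a)))"
proof -
  obtain ps ori where *: "three_matchings n c b a" "set ps = {1..2 * n}" "ori \<in> arc_orientations b"
      "mult_cba n C c b a = three_matchings.product n c b a ps ori"
    by (rule mult_cba_product[OF assms(1-3)])
  show ?thesis
    using three_matchings.product_hom_left[OF *(1-3)] assms(4) unfolding *(4) b_OH_a_eq by blast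
qed

lemma mult_cba_hom_right:
  assumes "c \<in> cm" "b \<in> cm" "a \<in> cm" "x \<in> carrier (b_OH_a n (c, b))"
  shows "mult_cba n C c b a x \<in> hom (add_monoid (b_OH_a n (b, a))) (add_monoid (b_OH_a n (c, a)))"
proof -
  obtain ps ori where *: "three_matchings n c b a" "set ps = {1..2 * n}" "ori \<in> arc_orientations b"
      "mult_cba n C c b a = three_matchings.product n c b a ps ori"
    by (rule mult_cba_product[OF assms(1-3)])
  show ?thesis
    using three_matchings.product_hom_right[OF *(1-3)] assms(4) unfolding *(4) b_OH_a_eq by blast
qed

lemma mult_cba_closed:
  "\<lbrakk>c \<in> cm; b \<in> cm; a \<in> cm; x \<in> carrier (b_OH_a n (c, b)); y \<in> carrier (b_OH_a n (b, a))\<rbrakk>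
    \<Longrightarrow> mult_cba n C c b a x y \<in> carrier (b_OH_a n (c, a))"
  using hom_in_carrier[OF mult_cba_hom_left] by fastforce

lemma mult_cba_deg:
  assumes "c \<in> cm" "b \<in> cm" "a \<in> cm" "x \<in> b_OH_a_deg n (c, b) d" "y \<in> b_OH_a_deg n (b, a) e"
  shows "mult_cba n C c b a x y \<in> b_OH_a_deg n (c, a) (d + e)"
proof -
  obtain ps ori where *: "three_matchings n c b a" "set ps = {1..2 * n}" "ori \<in> arc_orientations b"
      "mult_cba n C c b a = three_matchings.product n c b a ps ori"
    by (rule mult_cba_product[OF assms(1-3)])
  show ?thesis
    using three_matchings.product_part[OF *(1-3)] assms(4,5) unfolding *(4) b_OH_a_deg_eq by blast
qed

lemma mult_cba_one_right:
  assumes "c \<in> cm" "a \<in> cm" "x \<in> carrier (b_OH_a n (c, a))"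
  shows "mult_cba n C c a a x \<one>\<^bsub>b_OH_a n (a, a)\<^esub> = x"
proof -
  obtain ps ori where *: "three_matchings n c a a" "set ps = {1..2 * n}" "ori \<in> arc_orientations a"
      "mult_cba n C c a a = three_matchings.product n c a a ps ori"
    by (rule mult_cba_product[OF assms(1,2,2)])
  show ?thesis
    using three_matchings.product_one_right[OF *(1-3) refl] assms(3) unfolding *(4) b_OH_a_eq by blast
qed

lemma mult_cba_one_left:
  assumes "c \<in> cm" "a \<in> cm" "y \<in> carrier (b_OH_a n (c, a))"
  shows "mult_cba n C c c a \<one>\<^bsub>b_OH_a n (c, c)\<^esub> y = y"
proof -
  obtain ps ori where *: "three_matchings n c c a" "set ps = {1..2 * n}" "ori \<in> arc_orientations c"
      "mult_cba n C c c a = three_matchings.product n c c a ps ori"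
    by (rule mult_cba_product[OF assms(1,1,2)])
  show ?thesis
    using three_matchings.product_one_left[OF *(1-3) refl] assms(3) unfolding *(4) b_OH_a_eq by blast
qed

lemma mult_OH_closed:
  assumes "x \<in> carrier R" "y \<in> carrier R"
  shows "x \<otimes>\<^bsub>R\<^esub> y \<in> carrier R"
proof (rule carrier_OH_I)
  fix p assume "p \<in> cm \<times> cm"
  then obtain c a where p: "p = (c, a)" "c \<in> cm" "a \<in> cm" by auto
  interpret B: ring "b_OH_a n p" by (rule ring_b_OH_a)
  have "mult_cba n C c b a (x (c, b)) (y (b, a)) \<in> carrier (b_OH_a n (c, a))" if "b \<in> cm" for b
    using that p assms component_carrier by (intro mult_cba_closed) auto
  then show "(x \<otimes>\<^bsub>R\<^esub> y) p \<in> carrier (b_OH_a n p)"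
    using B.finsum_closed[of "\<lambda>b. mult_cba n C c b a (x (c, b)) (y (b, a))" cm] p
    by (simp add: mult_OH Pi_iff)
qed (simp add: mult_OH)

lemma nonassoc_ring_OH: "nonassoc_ring R"
proof
  show "x \<otimes>\<^bsub>R\<^esub> y \<in> carrier R" if "x \<in> carrier R" "y \<in> carrier R" for x y
    using that by (rule mult_OH_closed)
  show "\<one>\<^bsub>R\<^esub> \<in> carrier R" by (rule one_closed_OH)
  show "\<one>\<^bsub>R\<^esub> \<otimes>\<^bsub>R\<^esub> x = x" if x: "x \<in> carrier R" for x
  proof (rule OH_eqI[OF mult_OH_closed[OF one_closed_OH x] x])
    fix p assume "p \<in> cm \<times> cm"
    then obtain c a where p: "p = (c, a)" "c \<in> cm" "a \<in> cm" by auto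
    interpret B: ring "b_OH_a n (c, a)" by (rule ring_b_OH_a)
    \<comment> \<open>For \<open>b\<close> different from \<open>c\<close> the component of the unit
      is zero, and additivity in the first argument makes the product vanish.\<close>
    have "mult_cba n C c b a (\<one>\<^bsub>R\<^esub> (c, b)) (x (b, a)) = (if c = b then x (c, a) else \<zero>\<^bsub>b_OH_a n (c, a)\<^esub>)"
      if b: "b \<in> cm" for b
      using hom_add_zero[OF ring_b_OH_a ring_b_OH_a mult_cba_hom_left[OF p(2) b p(3)]]
        component_carrier[OF x, of "(b, a)"] mult_cba_one_left[of b a "x (b, a)"] b p
      by (auto simp: one_OH_apply)
    note terms = this
    have "(\<one>\<^bsub>R\<^esub> \<otimes>\<^bsub>R\<^esub> x) p = (\<Oplus>\<^bsub>b_OH_a n (c, a)\<^esub>b\<in>cm. mult_cba n C c b a (\<one>\<^bsub>R\<^esub> (c, b)) (x (b, a)))"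
      using p by (simp add: mult_OH)
    also have "\<dots> = (\<Oplus>\<^bsub>b_OH_a n (c, a)\<^esub>b\<in>cm. if c = b then x (c, a) else \<zero>\<^bsub>b_OH_a n (c, a)\<^esub>)"
      using p component_carrier[OF x, of "(c, a)"] by (intro B.finsum_cong'[OF refl]) (auto simp: terms)
    also have "\<dots> = x (c, a)"
      by (rule B.finsum_singleton)
         (use p component_carrier[OF x, of "(c, a)"] finite_crossingless_matchings in auto)
    finally show "(\<one>\<^bsub>R\<^esub> \<otimes>\<^bsub>R\<^esub> x) p = x p" using p by simp
  qed
  show "x \<otimes>\<^bsub>R\<^esub> \<one>\<^bsub>R\<^esub> = x" if x: "x \<in> carrier R" for x
  proof (rule OH_eqI[OF mult_OH_closed[OF x one_closed_OH] x])
    fix p assume "p \<in> cm \<times> cm"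
    then obtain c a where p: "p = (c, a)" "c \<in> cm" "a \<in> cm" by auto
    interpret B: ring "b_OH_a n (c, a)" by (rule ring_b_OH_a)
    have "mult_cba n C c b a (x (c, b)) (\<one>\<^bsub>R\<^esub> (b, a)) = (if a = b then x (c, a) else \<zero>\<^bsub>b_OH_a n (c, a)\<^esub>)"
      if b: "b \<in> cm" for b
      using hom_add_zero[OF ring_b_OH_a ring_b_OH_a mult_cba_hom_right[OF p(2) b p(3)]]
        component_carrier[OF x, of "(c, b)"] mult_cba_one_right[of c a "x (c, a)"] b p
      by (auto simp: one_OH_apply)
    note terms = this
    have "(x \<otimes>\<^bsub>R\<^esub> \<one>\<^bsub>R\<^esub>) p = (\<Oplus>\<^bsub>b_OH_a n (c, a)\<^esub>b\<in>cm. mult_cba n C c b a (x (c, b)) (\<one>\<^bsub>R\<^esub> (b, a)))"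
      using p by (simp add: mult_OH)
    also have "\<dots> = (\<Oplus>\<^bsub>b_OH_a n (c, a)\<^esub>b\<in>cm. if a = b then x (c, a) else \<zero>\<^bsub>b_OH_a n (c, a)\<^esub>)"
      using p component_carrier[OF x, of "(c, a)"] by (intro B.finsum_cong'[OF refl]) (auto simp: terms)
    also have "\<dots> = x (c, a)"
      by (rule B.finsum_singleton)
         (use p component_carrier[OF x, of "(c, a)"] finite_crossingless_matchings in auto)
    finally show "(x \<otimes>\<^bsub>R\<^esub> \<one>\<^bsub>R\<^esub>) p = x p" using p by simp
  qed
  fix x y z assume xyz: "x \<in> carrier R" "y \<in> carrier R" "z \<in> carrier R"
  show "(x \<oplus>\<^bsub>R\<^esub> y) \<otimes>\<^bsub>R\<^esub> z = x \<otimes>\<^bsub>R\<^esub> z \<oplus>\<^bsub>R\<^esub> y \<otimes>\<^bsub>R\<^esub> z"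
  proof (rule OH_eqI)
    fix p assume "p \<in> cm \<times> cm"
    then obtain c a where p: "p = (c, a)" "c \<in> cm" "a \<in> cm" by auto
    interpret B: ring "b_OH_a n (c, a)" by (rule ring_b_OH_a)
    have cl: "mult_cba n C c b a (x (c, b)) (z (b, a)) \<in> carrier (b_OH_a n (c, a))"
        "mult_cba n C c b a (y (c, b)) (z (b, a)) \<in> carrier (b_OH_a n (c, a))" if "b \<in> cm" for b
      using that p xyz component_carrier by (auto intro!: mult_cba_closed)
    have "mult_cba n C c b a ((x \<oplus>\<^bsub>R\<^esub> y) (c, b)) (z (b, a)) =
        mult_cba n C c b a (x (c, b)) (z (b, a)) \<oplus>\<^bsub>b_OH_a n (c, a)\<^esub> mult_cba n C c b a (y (c, b)) (z (b, a))"
      if b: "b \<in> cm" for b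
      using hom_mult[OF mult_cba_hom_left[OF p(2) b p(3)], of "z (b, a)" "x (c, b)" "y (c, b)"]
        p b xyz component_carrier by (simp add: add_OH)
    note terms = this
    have "((x \<oplus>\<^bsub>R\<^esub> y) \<otimes>\<^bsub>R\<^esub> z) p =
        (\<Oplus>\<^bsub>b_OH_a n (c, a)\<^esub>b\<in>cm. mult_cba n C c b a ((x \<oplus>\<^bsub>R\<^esub> y) (c, b)) (z (b, a)))"
      using p by (simp add: mult_OH)
    also have "\<dots> = (\<Oplus>\<^bsub>b_OH_a n (c, a)\<^esub>b\<in>cm.
        mult_cba n C c b a (x (c, b)) (z (b, a)) \<oplus>\<^bsub>b_OH_a n (c, a)\<^esub> mult_cba n C c b a (y (c, b)) (z (b, a)))"
      using cl by (intro B.finsum_cong'[OF refl]) (auto simp: terms)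
    also have "\<dots> = (x \<otimes>\<^bsub>R\<^esub> z \<oplus>\<^bsub>R\<^esub> y \<otimes>\<^bsub>R\<^esub> z) p"
      using p cl by (simp add: mult_OH add_OH B.finsum_addf Pi_iff)
    finally show "((x \<oplus>\<^bsub>R\<^esub> y) \<otimes>\<^bsub>R\<^esub> z) p = (x \<otimes>\<^bsub>R\<^esub> z \<oplus>\<^bsub>R\<^esub> y \<otimes>\<^bsub>R\<^esub> z) p" .
  qed (use xyz mult_OH_closed in auto)
  show "z \<otimes>\<^bsub>R\<^esub> (x \<oplus>\<^bsub>R\<^esub> y) = z \<otimes>\<^bsub>R\<^esub> x \<oplus>\<^bsub>R\<^esub> z \<otimes>\<^bsub>R\<^esub> y"
  proof (rule OH_eqI)
    fix p assume "p \<in> cm \<times> cm"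
    then obtain c a where p: "p = (c, a)" "c \<in> cm" "a \<in> cm" by auto
    interpret B: ring "b_OH_a n (c, a)" by (rule ring_b_OH_a)
    have cl: "mult_cba n C c b a (z (c, b)) (x (b, a)) \<in> carrier (b_OH_a n (c, a))"
        "mult_cba n C c b a (z (c, b)) (y (b, a)) \<in> carrier (b_OH_a n (c, a))" if "b \<in> cm" for b
      using that p xyz component_carrier by (auto intro!: mult_cba_closed)
    have "mult_cba n C c b a (z (c, b)) ((x \<oplus>\<^bsub>R\<^esub> y) (b, a)) =
        mult_cba n C c b a (z (c, b)) (x (b, a)) \<oplus>\<^bsub>b_OH_a n (c, a)\<^esub> mult_cba n C c b a (z (c, b)) (y (b, a))"
      if b: "b \<in> cm" for b
      using hom_mult[OF mult_cba_hom_right[OF p(2) b p(3)], of "z (c, b)" "x (b, a)" "y (b, a)"]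
        p b xyz component_carrier by (simp add: add_OH)
    note terms = this
    have "(z \<otimes>\<^bsub>R\<^esub> (x \<oplus>\<^bsub>R\<^esub> y)) p =
        (\<Oplus>\<^bsub>b_OH_a n (c, a)\<^esub>b\<in>cm. mult_cba n C c b a (z (c, b)) ((x \<oplus>\<^bsub>R\<^esub> y) (b, a)))"
      using p by (simp add: mult_OH)
    also have "\<dots> = (\<Oplus>\<^bsub>b_OH_a n (c, a)\<^esub>b\<in>cm.
        mult_cba n C c b a (z (c, b)) (x (b, a)) \<oplus>\<^bsub>b_OH_a n (c, a)\<^esub> mult_cba n C c b a (z (c, b)) (y (b, a)))"
      using cl by (intro B.finsum_cong'[OF refl]) (auto simp: terms)
    also have "\<dots> = (z \<otimes>\<^bsub>R\<^esub> x \<oplus>\<^bsub>R\<^esub> z \<otimes>\<^bsub>R\<^esub> y) p"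
      using p cl by (simp add: mult_OH add_OH B.finsum_addf Pi_iff)
    finally show "(z \<otimes>\<^bsub>R\<^esub> (x \<oplus>\<^bsub>R\<^esub> y)) p = (z \<otimes>\<^bsub>R\<^esub> x \<oplus>\<^bsub>R\<^esub> z \<otimes>\<^bsub>R\<^esub> y) p" .
  qed (use xyz mult_OH_closed in auto)
qed


section \<open>Direct sum decomposition by homogeneous projections\<close>

subsection \<open>The grading\<close>

lemma OH_deg_iff: "x \<in> OH_deg n d \<longleftrightarrow> x \<in> carrier R \<and> (\<forall>p\<in>cm \<times> cm. x p \<in> b_OH_a_deg n p d)"
  by (simp add: OH_deg_def OH_def)

lemma b_OH_a_deg_zero: "\<zero>\<^bsub>b_OH_a n p\<^esub> \<in> b_OH_a_deg n p d"
  by (cases p) (simp add: b_OH_a_eq b_OH_a_deg_eq exterior_part_zero)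

lemma b_OH_a_deg_add:
  "\<lbrakk>x \<in> b_OH_a_deg n p d; y \<in> b_OH_a_deg n p d\<rbrakk> \<Longrightarrow> x \<oplus>\<^bsub>b_OH_a n p\<^esub> y \<in> b_OH_a_deg n p d"
  by (cases p) (simp add: b_OH_a_eq b_OH_a_deg_eq exterior_part_add)

lemma b_OH_a_deg_minus:
  "x \<in> b_OH_a_deg n p d \<Longrightarrow> \<ominus>\<^bsub>b_OH_a n p\<^esub> x \<in> b_OH_a_deg n p d"
  by (cases p) (simp add: b_OH_a_eq b_OH_a_deg_eq exterior_part_minus)

lemma b_OH_a_deg_carrier: "x \<in> b_OH_a_deg n p d \<Longrightarrow> x \<in> carrier (b_OH_a n p)"
  by (cases p) (simp add: b_OH_a_eq b_OH_a_deg_eq exterior_part_carrier)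

lemma b_OH_a_deg_finsum:
  assumes "finite D" "\<And>i. i \<in> D \<Longrightarrow> f i \<in> b_OH_a_deg n p d"
  shows "(\<Oplus>\<^bsub>b_OH_a n p\<^esub>i\<in>D. f i) \<in> b_OH_a_deg n p d"
  using assms
proof (induction D rule: finite_induct)
  interpret B: ring "b_OH_a n p" by (rule ring_b_OH_a)
  case empty
  show ?case by (simp add: b_OH_a_deg_zero)
next
  interpret B: ring "b_OH_a n p" by (rule ring_b_OH_a)
  case (insert i D)
  then show ?case
    by (subst B.finsum_insert) (auto intro: b_OH_a_deg_add b_OH_a_deg_carrier)
qed

lemma minus_OH:
  assumes "x \<in> carrier R"
  shows "\<ominus>\<^bsub>R\<^esub> x = (\<lambda>p\<in>cm \<times> cm. \<ominus>\<^bsub>b_OH_a n p\<^esub> x p)"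
proof (rule minus_equality)
  let ?y = "\<lambda>p\<in>cm \<times> cm. \<ominus>\<^bsub>b_OH_a n p\<^esub> x p"
  have grp: "abelian_group (b_OH_a n p)" for p
    by (rule ring.is_abelian_group[OF ring_b_OH_a])
  show "?y \<in> carrier R"
    by (rule carrier_OH_I)
       (use abelian_group.a_inv_closed[OF grp] component_carrier[OF assms] in auto)
  show "?y \<oplus>\<^bsub>R\<^esub> x = \<zero>\<^bsub>R\<^esub>"
    unfolding add_OH zero_OH
    by (rule restrict_ext) (use abelian_group.l_neg[OF grp] component_carrier[OF assms] in auto)
qed (rule assms)

lemma OH_deg_subgroup: "additive_subgroup (OH_deg n d) R"
proof (rule additive_subgroupI, rule group.subgroupI[OF a_group])
  show "OH_deg n d \<subseteq> carrier (add_monoid R)" by (auto simp: OH_deg_iff)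
  have "\<zero>\<^bsub>R\<^esub> \<in> OH_deg n d"
    using b_OH_a_deg_zero by (simp add: OH_deg_iff) (simp add: zero_OH)
  then show "OH_deg n d \<noteq> {}" by blast
  show "inv\<^bsub>add_monoid R\<^esub> x \<in> OH_deg n d" if x: "x \<in> OH_deg n d" for x
  proof -
    have "\<ominus>\<^bsub>R\<^esub> x \<in> OH_deg n d"
      using x b_OH_a_deg_minus by (simp add: OH_deg_iff) (simp add: minus_OH)
    then show ?thesis by (simp add: a_inv_def)
  qed
  show "x \<otimes>\<^bsub>add_monoid R\<^esub> y \<in> OH_deg n d" if "x \<in> OH_deg n d" "y \<in> OH_deg n d" for x y
    using that b_OH_a_deg_add by (simp add: OH_deg_iff) (simp add: add_OH)
qed

lemma OH_deg_mult:
  assumes "x \<in> OH_deg n d" "y \<in> OH_deg n e"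
  shows "x \<otimes>\<^bsub>R\<^esub> y \<in> OH_deg n (d + e)"
  unfolding OH_deg_iff
proof (intro conjI ballI)
  show "x \<otimes>\<^bsub>R\<^esub> y \<in> carrier R" using assms by (auto simp: OH_deg_iff intro: mult_OH_closed)
  fix p assume "p \<in> cm \<times> cm"
  then obtain c a where p: "p = (c, a)" "c \<in> cm" "a \<in> cm" by auto
  have "(\<Oplus>\<^bsub>b_OH_a n p\<^esub>b\<in>cm. mult_cba n C c b a (x (c, b)) (y (b, a))) \<in> b_OH_a_deg n p (d + e)"
    unfolding p(1) using assms p finite_crossingless_matchings
    by (intro b_OH_a_deg_finsum mult_cba_deg) (auto simp: OH_deg_iff)
  then show "(x \<otimes>\<^bsub>R\<^esub> y) p \<in> b_OH_a_deg n p (d + e)" using p by (simp add: mult_OH)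
qed

text \<open>The circles of \<open>W(a)a\<close> are the \<open>n\<close> doubled arcs of
  \<open>a\<close>, so the empty wedge has degree \<open>n - n = 0\<close>.\<close>

lemma OH_deg_one: "\<one>\<^bsub>R\<^esub> \<in> OH_deg n 0"
  unfolding OH_deg_iff
proof (intro conjI ballI one_closed_OH)
  fix p assume "p \<in> cm \<times> cm"
  then obtain b a where p: "p = (b, a)" "b \<in> cm" "a \<in> cm" by auto
  show "\<one>\<^bsub>R\<^esub> p \<in> b_OH_a_deg n p 0"
  proof (cases "b = a")
    case False
    then show ?thesis using p b_OH_a_deg_zero by (simp add: one_OH_apply)
  next
    case True
    have pm: "perfect_matching {1..2 * n} a" using p crossingless_matchingD by blast
    have "connected_comp (a \<union> a) i = A" if A: "A \<in> a" "i \<in> A" for A i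
    proof
      show "connected_comp (a \<union> a) i \<subseteq> A"
      proof (rule connected_comp_least[OF A(2)])
        show "y \<in> A" if "x \<in> A" "{x, y} \<in> a \<union> a" for x y
          using perfect_matching_unique[OF pm, of "{x, y}" A x] that A(1) by blast
      qed
      show "A \<subseteq> connected_comp (a \<union> a) i"
      proof
        fix j assume "j \<in> A"
        obtain k where k: "{i, k} \<in> a"
          using perfect_matching_partner[OF pm, of i] perfect_matchingD(4)[OF pm A(1)] A(2) by blast
        then have "A = {i, k}" using perfect_matching_unique[OF pm, of "{i, k}" A i] A by blast
        then have "j = i \<or> {i, j} \<in> a \<union> a" using \<open>j \<in> A\<close> k by auto
        then show "j \<in> connected_comp (a \<union> a) i" using connected_comp_edge by auto
      qed
    qed
    note comp = this
    have "circles n a a = a"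
    proof
      show "circles n a a \<subseteq> a"
      proof
        fix s assume "s \<in> circles n a a"
        then obtain i where i: "i \<in> {1..2 * n}" "s = connected_comp (a \<union> a) i"
          unfolding circles_def connected_comps_def by (elim imageE)
        obtain A where "A \<in> a" "i \<in> A" using i(1) perfect_matchingD(1)[OF pm] by blast
        then show "s \<in> a" using comp[of A i] i(2) by simp
      qed
      show "a \<subseteq> circles n a a"
      proof
        fix A assume A: "A \<in> a"
        then obtain i where i: "i \<in> A" using perfect_matchingD(3)[OF pm A] by fastforce
        then have "i \<in> {1..2 * n}" using perfect_matchingD(4)[OF pm A] by blast
        then show "A \<in> circles n a a"
          using comp[OF A i] unfolding circles_def connected_comps_def by blast
      qed
    qed
    then have "card (circles n a a) = n" using perfect_matching_card[OF pm] by simp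
    then show ?thesis
      using True p by (simp add: one_OH_apply b_OH_a_eq b_OH_a_deg_eq exterior_part_one)
  qed
qed

text \<open>Each summand has its own degree function, since the number of circles varies. Because
  the projections are defined on the whole ring, they give both existence and uniqueness in
  \<open>OH_direct_sum\<close>.\<close>

definition OH_proj :: "int \<Rightarrow> OH_elem \<Rightarrow> OH_elem"
  where "OH_proj d x = (\<lambda>(b, a)\<in>cm \<times> cm.
    exterior_proj (circles n b a) (\<lambda>k. 2 * int k + int n - int (card (circles n b a)) = d) (x (b, a)))"

lemma OH_proj_deg:
  assumes "x \<in> carrier R" shows "OH_proj d x \<in> OH_deg n d"
proof -
  have p: "OH_proj d x p \<in> b_OH_a_deg n p d" if "p \<in> cm \<times> cm" for p
    using that component_carrier[OF assms that]
    by (cases p) (simp add: OH_proj_def b_OH_a_eq b_OH_a_deg_eq exterior_proj_part)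
  have "OH_proj d x \<in> carrier R"
  proof (rule carrier_OH_I)
    show "OH_proj d x p \<in> carrier (b_OH_a n p)" if "p \<in> cm \<times> cm" for p
      using b_OH_a_deg_carrier[OF p[OF that]] .
  qed (simp add: OH_proj_def)
  then show ?thesis using p by (simp add: OH_deg_iff)
qed

lemma OH_proj_same: "x \<in> OH_deg n d \<Longrightarrow> OH_proj d x = x"
  by (rule OH_eqI)
     (auto simp: OH_deg_iff b_OH_a_deg_eq OH_proj_def exterior_proj_id
       dest: OH_proj_deg[unfolded OH_deg_iff, THEN conjunct1])

lemma OH_proj_other: "\<lbrakk>x \<in> OH_deg n d; d \<noteq> e\<rbrakk> \<Longrightarrow> OH_proj e x = \<zero>\<^bsub>R\<^esub>"
  by (auto simp: OH_proj_def zero_OH OH_deg_iff b_OH_a_deg_eq b_OH_a_eq fun_eq_iff restrict_def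
      intro!: exterior_proj_other)

text \<open>The source of uniqueness: by additivity the homogeneous terms of a finite sum can be
  recovered from the sum.\<close>

lemma OH_proj_finsum:
  assumes D: "finite D" and y: "\<And>d. d \<in> D \<Longrightarrow> y d \<in> OH_deg n d"
  shows "OH_proj e (\<Oplus>\<^bsub>R\<^esub>d\<in>D. y d) = (if e \<in> D then y e else \<zero>\<^bsub>R\<^esub>)"
proof -
  have yc: "y d \<in> carrier R" if "d \<in> D" for d using y[OF that] by (simp add: OH_deg_iff)
  have sc: "(\<Oplus>\<^bsub>R\<^esub>d\<in>D. y d) \<in> carrier R" by (rule finsum_closed) (use yc in auto)
  have pc: "OH_proj e x \<in> carrier R" if "x \<in> carrier R" for x
    using OH_proj_deg[OF that] by (simp add: OH_deg_iff)
  have "OH_proj e (\<Oplus>\<^bsub>R\<^esub>d\<in>D. y d) = (\<Oplus>\<^bsub>R\<^esub>d\<in>D. OH_proj e (y d))"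
  proof (rule OH_eqI[OF pc[OF sc]])
    show "(\<Oplus>\<^bsub>R\<^esub>d\<in>D. OH_proj e (y d)) \<in> carrier R" by (rule finsum_closed) (use yc pc in auto)
    fix p assume p: "p \<in> cm \<times> cm"
    obtain b a where ba: "p = (b, a)" by fastforce
    let ?\<pi> = "exterior_proj (circles n b a) (\<lambda>k. 2 * int k + int n - int (card (circles n b a)) = e)"
    have "OH_proj e (\<Oplus>\<^bsub>R\<^esub>d\<in>D. y d) p = ?\<pi> (\<Oplus>\<^bsub>b_OH_a n p\<^esub>d\<in>D. y d p)"
      using p finsum_OH[OF D _ p, of y] yc by (simp add: OH_proj_def ba Pi_iff)
    also have "\<dots> = (\<Oplus>\<^bsub>b_OH_a n p\<^esub>d\<in>D. ?\<pi> (y d p))"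
      unfolding ba b_OH_a_eq
      by (rule hom_add_finsum[OF ring_exterior_algebra ring_exterior_algebra exterior_proj_hom D])
         (use component_carrier[OF yc p] in \<open>auto simp: ba b_OH_a_eq\<close>)
    also have "\<dots> = (\<Oplus>\<^bsub>b_OH_a n p\<^esub>d\<in>D. OH_proj e (y d) p)"
      using p by (simp add: OH_proj_def ba)
    also have "\<dots> = (\<Oplus>\<^bsub>R\<^esub>d\<in>D. OH_proj e (y d)) p"
      by (rule finsum_OH[OF D _ p, symmetric]) (use yc pc in auto)
    finally show "OH_proj e (\<Oplus>\<^bsub>R\<^esub>d\<in>D. y d) p = (\<Oplus>\<^bsub>R\<^esub>d\<in>D. OH_proj e (y d)) p" .
  qed
  also have "\<dots> = (\<Oplus>\<^bsub>R\<^esub>d\<in>D. if e = d then y d else \<zero>\<^bsub>R\<^esub>)"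
  proof (rule finsum_cong')
    fix d assume "d \<in> D"
    then show "OH_proj e (y d) = (if e = d then y d else \<zero>\<^bsub>R\<^esub>)"
      using OH_proj_same[OF y] OH_proj_other[OF y, of d e] by auto
  qed (use yc in auto)
  also have "\<dots> = (if e \<in> D then y e else \<zero>\<^bsub>R\<^esub>)"
  proof (cases "e \<in> D")
    case True
    then show ?thesis using D yc by (simp add: finsum_singleton Pi_iff)
  next
    case False
    have "(\<Oplus>\<^bsub>R\<^esub>d\<in>D. if e = d then y d else \<zero>\<^bsub>R\<^esub>) = (\<Oplus>\<^bsub>R\<^esub>d\<in>D. \<zero>\<^bsub>R\<^esub>)"
      by (rule finsum_cong') (use False in auto)
    then show ?thesis using False by simp
  qed
  finally show ?thesis .
qed

lemma OH_decomposition: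
  assumes x: "x \<in> carrier R"
  shows "finite {d. OH_proj d x \<noteq> \<zero>\<^bsub>R\<^esub>}" "x = (\<Oplus>\<^bsub>R\<^esub>d\<in>{d. OH_proj d x \<noteq> \<zero>\<^bsub>R\<^esub>}. OH_proj d x)"
proof -
  have "\<exists>D. finite D \<and> (\<forall>d. d \<notin> D \<longrightarrow> OH_proj d x p = \<zero>\<^bsub>b_OH_a n p\<^esub>) \<and>
      (\<forall>E. finite E \<longrightarrow> D \<subseteq> E \<longrightarrow> x p = (\<Oplus>\<^bsub>b_OH_a n p\<^esub>d\<in>E. OH_proj d x p))" if p: "p \<in> cm \<times> cm" for p
  proof -
    obtain b a where ba: "p = (b, a)" by fastforce
    have xp: "x p \<in> carrier (exterior_algebra (circles n b a))"
      using component_carrier[OF x p] by (simp add: ba b_OH_a_eq)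
    have pr: "OH_proj d x p = exterior_proj (circles n b a)
        (\<lambda>k. 2 * int k + int n - int (card (circles n b a)) = d) (x p)" for d
      using p by (simp add: OH_proj_def ba)
    show ?thesis
      unfolding pr
      by (rule exterior_decomposition[OF xp, of "\<lambda>k. 2 * int k + int n - int (card (circles n b a))"])
         (auto simp: ba b_OH_a_eq)
  qed
  then obtain D where D: "\<And>p. p \<in> cm \<times> cm \<Longrightarrow> finite (D p)"
      "\<And>p d. \<lbrakk>p \<in> cm \<times> cm; d \<notin> D p\<rbrakk> \<Longrightarrow> OH_proj d x p = \<zero>\<^bsub>b_OH_a n p\<^esub>"
      "\<And>p E. \<lbrakk>p \<in> cm \<times> cm; finite E; D p \<subseteq> E\<rbrakk> \<Longrightarrow> x p = (\<Oplus>\<^bsub>b_OH_a n p\<^esub>d\<in>E. OH_proj d x p)"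
    by metis
  \<comment> \<open>One finite set of degrees that serves all components, as there are finitely many
    pairs of matchings.\<close>
  let ?E = "\<Union>p\<in>cm \<times> cm. D p" and ?D = "{d. OH_proj d x \<noteq> \<zero>\<^bsub>R\<^esub>}"
  have pc: "OH_proj d x \<in> carrier R" for d using OH_proj_deg[OF x] by (simp add: OH_deg_iff)
  have finE: "finite ?E" using D(1) finite_crossingless_matchings by blast
  have sub: "?D \<subseteq> ?E"
  proof
    fix d assume d: "d \<in> ?D"
    show "d \<in> ?E"
    proof (rule ccontr)
      assume "d \<notin> ?E"
      then have "OH_proj d x p = \<zero>\<^bsub>R\<^esub> p" if "p \<in> cm \<times> cm" for p
        using D(2)[OF that] that by (auto simp: zero_OH)
      then have "OH_proj d x = \<zero>\<^bsub>R\<^esub>" by (rule OH_eqI[OF pc zero_closed])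
      then show False using d by simp
    qed
  qed
  then show fin: "finite ?D" using finE finite_subset by blast
  have "x = (\<Oplus>\<^bsub>R\<^esub>d\<in>?E. OH_proj d x)"
  proof (rule OH_eqI[OF x])
    show "(\<Oplus>\<^bsub>R\<^esub>d\<in>?E. OH_proj d x) \<in> carrier R" by (rule finsum_closed) (use pc in auto)
    show "x p = (\<Oplus>\<^bsub>R\<^esub>d\<in>?E. OH_proj d x) p" if p: "p \<in> cm \<times> cm" for p
      using D(3)[OF p finE] finsum_OH[OF finE _ p, of "\<lambda>d. OH_proj d x"] pc p by auto
  qed
  also have "\<dots> = (\<Oplus>\<^bsub>R\<^esub>d\<in>?D. OH_proj d x)"
    by (rule add.finprod_mono_neutral_cong_right[OF finE sub]) (use pc in auto)
  finally show "x = (\<Oplus>\<^bsub>R\<^esub>d\<in>?D. OH_proj d x)" .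
qed

lemma OH_direct_sum:
  assumes x: "x \<in> carrier R"
  shows "\<exists>!y. (\<forall>d. y d \<in> OH_deg n d) \<and> finite {d. y d \<noteq> \<zero>\<^bsub>R\<^esub>} \<and>
    x = (\<Oplus>\<^bsub>R\<^esub>d\<in>{d. y d \<noteq> \<zero>\<^bsub>R\<^esub>}. y d)"
proof (rule ex1I)
  show "(\<forall>d. OH_proj d x \<in> OH_deg n d) \<and> finite {d. OH_proj d x \<noteq> \<zero>\<^bsub>R\<^esub>} \<and>
      x = (\<Oplus>\<^bsub>R\<^esub>d\<in>{d. OH_proj d x \<noteq> \<zero>\<^bsub>R\<^esub>}. OH_proj d x)"
    using OH_proj_deg[OF x] OH_decomposition[OF x] by blast
  fix y assume y: "(\<forall>d. y d \<in> OH_deg n d) \<and> finite {d. y d \<noteq> \<zero>\<^bsub>R\<^esub>} \<and>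
      x = (\<Oplus>\<^bsub>R\<^esub>d\<in>{d. y d \<noteq> \<zero>\<^bsub>R\<^esub>}. y d)"
  show "y = (\<lambda>d. OH_proj d x)"
  proof
    fix e
    have "OH_proj e x = OH_proj e (\<Oplus>\<^bsub>R\<^esub>d\<in>{d. y d \<noteq> \<zero>\<^bsub>R\<^esub>}. y d)" using y by simp
    \<comment> \<open>For \<open>e\<close> outside the support the default value zero in
      \<open>OH_proj_finsum\<close> agrees with \<open>y e\<close>.\<close>
    also have "\<dots> = y e" using OH_proj_finsum[of "{d. y d \<noteq> \<zero>\<^bsub>R\<^esub>}" y e] y by auto
    finally show "y e = OH_proj e x" by simp
  qed
qed

end

theorem theorem1:
  fixes n :: nat and C :: mult_rule
  assumes "C \<in> mult_rules n"
  shows "graded_nonassoc_ring (OH n C) (OH_deg n)"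
proof -
  interpret OH_rule n C by (rule OH_rule.intro[OF assms])
  show ?thesis
    by (intro graded_nonassoc_ring.intro nonassoc_ring_OH graded_nonassoc_ring_axioms.intro
        OH_deg_subgroup OH_direct_sum OH_deg_mult OH_deg_one)
qed

end
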